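(* Let $(a_1,\dots,a_k)\in\mathcal{A}$ and suppose that $(a_1,\dots,a_{k-1})\in\mathcal{S}_1$ and $a_k>g_2(a_1,\dots,a_{k-1})$. Assume further that there exist $0<\gamma_1,\dots,\gamma_{k-1}<1$ such that for each $1\le i\le k-1$, $$\lim_{x\to\infty}\frac{(\phi_i\circ\phi_k^{-1})(x)}{x^{\gamma_i}}=1.$$ Let $\nu=\frac1Z e^{p_1\phi_1+\dots+p_{k-1}\phi_{k-1}}dx$ be the (unique) probability measure of this form on $(0,\infty)$ satisfying $\int\phi_i\,d\nu=a_i$ for $1\le i\le k-1$, let $1\le m\le k-1$ be the largest index such that $p_m\ne0$, let $\mathbb{Q}=\nu^{\otimes\mathbb{N}}$, and let $M_n=\max_{1\le i\le n}\frac{\phi_k(X_i)}{n}$. Then for any $\epsilon>0$, $$\limsup_{\delta\to0}\limsup_{n\to\infty}\frac{1}{n^{\gamma_m}}\log\mathbb{Q}\big(M_n<a_k-g_2(a_1,\dots,a_{k-1})-\epsilon\ \big|\ C_n^\delta\big)<0.$$ In particular, localization happens in the sense that for any $\epsilon>0$, $$\lim_{\delta\to0}\lim_{n\to\infty}\mathbb{Q}\big(|M_n-(a_k-g_2(a_1,\dots,a_{k-1}))|<\epsilon\ \big|\ C_n^\delta\big)=1.$$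
   Context: Fix an integer $k\ge2$ and functions $\phi_1,\dots,\phi_k:(0,\infty)\to(0,\infty)$ such that: (C1) each $\phi_i$ is $C^1$, increasing, and $\lim_{x\to\infty}\phi_i(x)=\infty$; (C2) for each $i$ and any $c>0$, $\int_0^\infty e^{-c\phi_i}dx<\infty$; (C3) there exists $\kappa>1$ such that for each $1\le i\le k-1$, $\phi_i(x)^\kappa<\phi_{i+1}(x)$ for all sufficiently large $x$; (C4) there exist $C,M>0$ such that $x>C$ implies $\frac1C\phi_i(x)^{-M}<\phi_i'(x)<C\phi_i(x)^M$ for each $i$. $\mathcal{M}_1((0,\infty))$ is the space of Borel probability measures on $(0,\infty)$ with the weak topology, and $\int$ means integration over $(0,\infty)$. Let $\lambda=\frac1Z e^{-\phi_1}dx$ be a probability measure on $(0,\infty)$. On $\Omega=(0,\infty)^{\mathbb{N}}$ let $X_i$ be the coordinate projections. Put $S_n^i=\frac1n(\phi_i(X_1)+\dots+\phi_i(X_n))$ and $C_n^\delta=\bigcap_{i=1}^k\{|S_n^i-a_i|\le\delta\}$ for $\delta>0$. The differential entropy is $h(\mu)=-\int\frac{d\mu}{dx}\log\big(\frac{d\mu}{dx}\big)dx$ if $\mu\ll dx$ and $h(\mu)=-\infty$ otherwise. Let $\mathcal{A}_1$ be the interior of the set of $(v_1,\dots,v_{k-1})\in(0,\infty)^{k-1}$ for which there is $\mu\in\mathcal{M}_1((0,\infty))$ with $h(\mu)\ne-\infty$, $\int\phi_i\,d\mu=v_i$ for $1\le i\le k-1$, and $\int\phi_k\,d\mu<\infty$.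 For $(v_1,\dots,v_{k-1})\in\mathcal{A}_1$ let $g_1(v_1,\dots,v_{k-1})=\inf\{\int\phi_k\,d\mu : \mu\in\mathcal{M}_1((0,\infty)),\ h(\mu)\ne-\infty,\ \int\phi_i\,d\mu=v_i\ (1\le i\le k-1)\}$. It is assumed that $g_1:\mathcal{A}_1\to\mathbb{R}$ is continuous. The admissible set is $\mathcal{A}=\{(v_1,\dots,v_k): (v_1,\dots,v_{k-1})\in\mathcal{A}_1,\ v_k>g_1(v_1,\dots,v_{k-1})\}$. Let $H(p_1,\dots,p_k)=\log\int e^{p_1\phi_1+\dots+p_k\phi_k}d\lambda\in(-\infty,\infty]$ on $\mathbb{R}^k$, a convex function with subdifferential $\partial H$. Let $\pi_1(v_1,\dots,v_k)=(v_1,\dots,v_{k-1})$ and $\pi_2(v_1,\dots,v_k)=v_k$. $\mathcal{S}_1\subset\mathcal{A}_1$ is the set of $(v_1,\dots,v_{k-1})\in\mathcal{A}_1$ such that $(v_1,\dots,v_{k-1})\in\pi_1(\partial H(p_1,\dots,p_{k-1},0))$ for some $p_1,\dots,p_{k-1}\in\mathbb{R}$ (such $p$'s are then unique); for these $p$'s, $g_2(v_1,\dots,v_{k-1})=\inf\pi_2(\partial H(p_1,\dots,p_{k-1},0))$. Convention: $\log 0=-\infty$. *)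

theory Defs
  imports "HOL-Probability.Probability"
begin

text \<open>
  The functions \<open>\<phi> 1, \<dots>, \<phi> k\<close> are given as a family \<open>\<phi> :: nat \<Rightarrow> real \<Rightarrow> real\<close>; only the values
  \<open>\<phi> i x\<close> with \<open>1 \<le> i \<le> k\<close> and \<open>x > 0\<close> matter. A point of $\mathbb{R}^n$ is an extensional
  function on \<open>{1..n}\<close>, so that \<open>\<pi>\<^sub>1 : \<real>^k \<rightarrow> \<real>^(k-1)\<close> is restriction to \<open>{1..k - 1}\<close>.
\<close>

abbreviation vecs :: "nat \<Rightarrow> (nat \<Rightarrow> real) set"
  where "vecs n \<equiv> {1..n} \<rightarrow>\<^sub>E UNIV"

abbreviation vecs_top :: "nat \<Rightarrow> (nat \<Rightarrow> real) topology"
  where "vecs_top n \<equiv> product_topology (\<lambda>_. euclideanreal) {1..n}"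

definition proj1 :: "nat \<Rightarrow> (nat \<Rightarrow> real) \<Rightarrow> nat \<Rightarrow> real"
  where "proj1 k v = restrict v {1..k - 1}"

definition pos_lborel :: "real measure"
  where "pos_lborel = restrict_space lborel {0<..}"

definition pos_probs :: "real measure set"
  where "pos_probs = {\<mu>. prob_space \<mu> \<and> sets \<mu> = sets (restrict_space borel {0<..})}"

text \<open>
  Logarithm with \<open>log 0 = -\<infinity>\<close> and \<open>log \<infinity> = \<infinity>\<close>.
\<close>

definition elog :: "ennreal \<Rightarrow> ereal"
  where "elog t = (if t = 0 then -\<infinity> else if t = \<infinity> then \<infinity> else ereal (ln (enn2real t)))"

text \<open>
  The integral of \<open>- f log f\<close> is split into its positive and negative parts (\<open>ennreal\<close> is \<open>0\<close> on
  negative reals). If both are infinite the difference below is \<open>\<infinity>\<close> by the convention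
  \<open>\<infinity> - \<infinity> = \<infinity>\<close> of \<open>ereal\<close>. This never matters below: a finite integral of \<open>\<phi> 1\<close> against \<open>\<mu>\<close>,
  together with integrability of \<open>exp (- \<phi> 1)\<close>, makes the positive part finite.
\<close>

definition diff_entropy :: "real measure \<Rightarrow> ereal"
  where "diff_entropy \<mu> =
    (if absolutely_continuous pos_lborel \<mu> then
       (let f = (\<lambda>x. enn2real (RN_deriv pos_lborel \<mu> x))
        in enn2ereal (\<integral>\<^sup>+x. ennreal (- (f x * ln (f x))) \<partial>pos_lborel)
           - enn2ereal (\<integral>\<^sup>+x. ennreal (f x * ln (f x)) \<partial>pos_lborel))
     else -\<infinity>)"

text \<open>
  The measure \<open>(1/Z) exp (u x) dx\<close> on \<open>(0, \<infinity>)\<close>; it is a probability measure iff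
  \<open>0 < Z < \<infinity>\<close>.
\<close>

definition gibbs :: "(real \<Rightarrow> real) \<Rightarrow> real measure"
  where "gibbs u = density pos_lborel
    (\<lambda>x. ennreal (exp (u x)) / (\<integral>\<^sup>+y. ennreal (exp (u y)) \<partial>pos_lborel))"

definition constrained :: "nat \<Rightarrow> (nat \<Rightarrow> real \<Rightarrow> real) \<Rightarrow> (nat \<Rightarrow> real) \<Rightarrow> real measure set"
  where "constrained k \<phi> v = {\<mu> \<in> pos_probs. diff_entropy \<mu> \<noteq> -\<infinity> \<and>
    (\<forall>i\<in>{1..k - 1}. (\<integral>\<^sup>+x. ennreal (\<phi> i x) \<partial>\<mu>) = ennreal (v i))}"

definition A1 :: "nat \<Rightarrow> (nat \<Rightarrow> real \<Rightarrow> real) \<Rightarrow> (nat \<Rightarrow> real) set"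
  where "A1 k \<phi> = vecs_top (k - 1) interior_of
    {v \<in> {1..k - 1} \<rightarrow>\<^sub>E {0<..}. \<exists>\<mu>\<in>constrained k \<phi> v. (\<integral>\<^sup>+x. ennreal (\<phi> k x) \<partial>\<mu>) < \<infinity>}"

text \<open>
  The infimum is finite on \<open>A1\<close>, so \<open>enn2real\<close> loses nothing there.
\<close>

definition g1 :: "nat \<Rightarrow> (nat \<Rightarrow> real \<Rightarrow> real) \<Rightarrow> (nat \<Rightarrow> real) \<Rightarrow> real"
  where "g1 k \<phi> v = enn2real (INF \<mu>\<in>constrained k \<phi> v. \<integral>\<^sup>+x. ennreal (\<phi> k x) \<partial>\<mu>)"

definition admissible :: "nat \<Rightarrow> (nat \<Rightarrow> real \<Rightarrow> real) \<Rightarrow> (nat \<Rightarrow> real) set"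
  where "admissible k \<phi> = {v \<in> vecs k. proj1 k v \<in> A1 k \<phi> \<and> v k > g1 k \<phi> (proj1 k v)}"

definition logmgf :: "nat \<Rightarrow> (nat \<Rightarrow> real \<Rightarrow> real) \<Rightarrow> (nat \<Rightarrow> real) \<Rightarrow> ereal"
  where "logmgf k \<phi> p =
    elog (\<integral>\<^sup>+x. ennreal (exp (\<Sum>i=1..k. p i * \<phi> i x)) \<partial>gibbs (\<lambda>x. - \<phi> 1 x))"

definition subdifferential :: "nat \<Rightarrow> ((nat \<Rightarrow> real) \<Rightarrow> ereal) \<Rightarrow> (nat \<Rightarrow> real) \<Rightarrow> (nat \<Rightarrow> real) set"
  where "subdifferential n F p = {v \<in> vecs n. \<bar>F p\<bar> \<noteq> \<infinity> \<and>
    (\<forall>q\<in>vecs n. F q \<ge> F p + ereal (\<Sum>i=1..n. v i * (q i - p i)))}"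

text \<open>
  The parameters \<open>(p 1, \<dots>, p (k - 1), 0)\<close>, as points of $\mathbb{R}^k$, that witness
  membership of \<open>v\<close> in \<open>S1\<close>.
\<close>

definition tilts :: "nat \<Rightarrow> (nat \<Rightarrow> real \<Rightarrow> real) \<Rightarrow> (nat \<Rightarrow> real) \<Rightarrow> (nat \<Rightarrow> real) set"
  where "tilts k \<phi> v =
    {p \<in> vecs k. p k = 0 \<and> v \<in> proj1 k ` subdifferential k (logmgf k \<phi>) p}"

definition S1 :: "nat \<Rightarrow> (nat \<Rightarrow> real \<Rightarrow> real) \<Rightarrow> (nat \<Rightarrow> real) set"
  where "S1 k \<phi> = {v \<in> A1 k \<phi>. tilts k \<phi> v \<noteq> {}}"

definition g2 :: "nat \<Rightarrow> (nat \<Rightarrow> real \<Rightarrow> real) \<Rightarrow> (nat \<Rightarrow> real) \<Rightarrow> real"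
  where "g2 k \<phi> v =
    Inf ((\<lambda>w. w k) ` subdifferential k (logmgf k \<phi>) (THE p. p \<in> tilts k \<phi> v))"

definition nu :: "nat \<Rightarrow> (nat \<Rightarrow> real \<Rightarrow> real) \<Rightarrow> (nat \<Rightarrow> real) \<Rightarrow> real measure"
  where "nu k \<phi> p = gibbs (\<lambda>x. \<Sum>i=1..k - 1. p i * \<phi> i x)"

definition fits :: "nat \<Rightarrow> (nat \<Rightarrow> real \<Rightarrow> real) \<Rightarrow> (nat \<Rightarrow> real) \<Rightarrow> (nat \<Rightarrow> real) \<Rightarrow> bool"
  where "fits k \<phi> a p \<longleftrightarrow> p \<in> vecs (k - 1) \<and> prob_space (nu k \<phi> p) \<and>
    (\<forall>i\<in>{1..k - 1}. (\<integral>\<^sup>+x. ennreal (\<phi> i x) \<partial>nu k \<phi> p) = ennreal (a i))"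

text \<open>
  The sample \<open>X\<^sub>1, \<dots>, X\<^sub>n\<close> consists of the coordinates \<open>\<omega> 0, \<dots>, \<omega> (n - 1)\<close> of
  \<open>\<omega> :: nat \<Rightarrow> real\<close>.
\<close>

definition iid :: "real measure \<Rightarrow> (nat \<Rightarrow> real) measure"
  where "iid \<mu> = Pi\<^sub>M UNIV (\<lambda>_. \<mu>)"

definition emp_mean :: "(real \<Rightarrow> real) \<Rightarrow> nat \<Rightarrow> (nat \<Rightarrow> real) \<Rightarrow> real"
  where "emp_mean f n \<omega> = (\<Sum>j<n. f (\<omega> j)) / real n"

definition near :: "nat \<Rightarrow> (nat \<Rightarrow> real \<Rightarrow> real) \<Rightarrow> (nat \<Rightarrow> real) \<Rightarrow> real \<Rightarrow> nat \<Rightarrow> (nat \<Rightarrow> real) \<Rightarrow> bool"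
  where "near k \<phi> a \<delta> n \<omega> \<longleftrightarrow> (\<forall>i\<in>{1..k}. \<bar>emp_mean (\<phi> i) n \<omega> - a i\<bar> \<le> \<delta>)"

definition max_share :: "(real \<Rightarrow> real) \<Rightarrow> nat \<Rightarrow> (nat \<Rightarrow> real) \<Rightarrow> real"
  where "max_share f n \<omega> = Max ((\<lambda>j. f (\<omega> j) / real n) ` {..<n})"

end

theory Submission
  imports Defs
begin

text \<open>
  Let \<open>\<nu>\<close> be the Gibbs measure with the prescribed first \<open>k - 1\<close> moments, \<open>Y = \<phi> k\<close>, \<open>G = \<integral> Y d\<nu>\<close>,
  and \<open>b = a k - g2\<close>.

  First, \<open>g2 = G\<close>. At a parameter \<open>(p, 0)\<close> the log-moment function can be differentiated in every
  direction \<open>d\<close> with \<open>d k = -1\<close>, because \<open>\<phi> k\<close> dominates the other potentials and \<open>\<Sum> d i * \<phi> i\<close> is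
  therefore bounded above; the one-sided derivative is at most \<open>\<Sum> d i * \<integral> \<phi> i d\<nu>\<close>
  (\<open>supporting_slope_le_mean\<close>). As the first \<open>k - 1\<close> components of \<open>d\<close> are free, a subgradient has
  exactly the moments of \<open>\<nu>\<close> in these components and a last component of at least \<open>G\<close>
  (\<open>supporting_vector\<close>); by Jensen's inequality the moment vector of \<open>\<nu>\<close> is itself a subgradient
  (\<open>mean_in_subdifferential\<close>). The parameters of \<open>\<nu>\<close> are determined by its moments, because equality
  in Jensen's inequality would make a nontrivial combination of the potentials constant
  (\<open>mean_determines_parameter\<close>).

  Secondly, the last nonzero parameter \<open>p m\<close> is negative, and \<open>\<phi> m\<close> behaves like \<open>Y^\<gamma>\<close> with
  \<open>\<gamma> = \<gamma> m < 1\<close>. So \<open>Y\<close> has a stretched-exponential tail: \<open>\<nu>(Y > t) = exp (- (c + o(1)) t^\<gamma>)\<close> with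
  \<open>c = - p m\<close>. The event \<open>near\<close> asks the sum of \<open>n\<close> copies of \<open>Y\<close> to exceed its mean by about \<open>n b\<close>.
  Since \<open>y \<mapsto> y^\<gamma>\<close> is concave, it is cheapest to put the whole excess into one coordinate:

  \<^item> if one coordinate has \<open>Y\<close> slightly below \<open>n b\<close> and the others obey the law of large numbers,
    \<open>near\<close> occurs; its probability is thus at least \<open>exp (- (c + o(1)) b^\<gamma> n^\<gamma>)\<close>
    (\<open>near_lower_bound\<close>). The other empirical means do not notice that coordinate, where
    \<open>\<phi> i = o(n)\<close>.

  \<^item> if all coordinates have \<open>Y \<le> n d\<close> with \<open>d = b - \<epsilon>\<close>, a Chernoff bound for the truncated
    variables gives the cost \<open>c b d^(\<gamma> - 1) n^\<gamma>\<close>, which is larger as \<open>d < b\<close>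
    (\<open>truncated_chernoff\<close>, \<open>undershoot_unlikely\<close>).

  \<^item> a coordinate with \<open>Y \<ge> n (b + \<epsilon>)\<close> costs \<open>c (b + \<epsilon>)^\<gamma> n^\<gamma>\<close>, again too much
    (\<open>overshoot_unlikely\<close>).

  Dividing by the lower bound for \<open>near\<close>, both deviations of the maximum have conditional probability
  at most \<open>exp (- \<rho> n^\<gamma>)\<close> for some \<open>\<rho> > 0\<close>, uniformly for small \<open>\<delta>\<close> in the case of an undershoot.
\<close>

section \<open>A quadratic bound and independent samples\<close>

text \<open>
  Only an upper bound on \<open>z\<close> enters, so that this applies to random variables with an unbounded
  negative part. It bounds exponential moments of truncated variables, and it differentiates
  \<open>\<integral> exp (t * f)\<close> at \<open>t = 0\<close> when \<open>f\<close> is bounded above.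
\<close>

lemma exp_le_quadratic:
  fixes z B :: real
  assumes "z \<le> B" "0 \<le> B"
  shows "exp z \<le> 1 + z + z\<^sup>2 * exp B"
proof (cases "z \<ge> 0")
  case True
  obtain t where t: "\<bar>t\<bar> \<le> \<bar>z\<bar>" "exp z = (\<Sum>m<2. z ^ m / fact m) + exp t / fact 2 * z ^ 2"
    using Maclaurin_exp_le[of z 2] by blast
  have "exp t \<le> exp B" using t(1) True assms by auto
  then have "exp t / fact 2 \<le> exp B" using exp_ge_zero[of t] by (simp add: eval_nat_numeral del: exp_ge_zero exp_le_cancel_iff)
  then have "exp t / fact 2 * z^2 \<le> exp B * z^2"
    by (intro mult_right_mono) auto
  then show ?thesis using t(2) by (simp add: eval_nat_numeral mult.commute)
next
  case False
  define w where "w = - z"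
  have w: "w \<ge> 0" using False by (simp add: w_def)
  have e: "1 + w + w\<^sup>2 / 2 \<le> exp w" using exp_lower_Taylor_quadratic[OF w] .
  have q: "0 \<le> 1 - w + w\<^sup>2"
    using zero_le_power2[of "w - 1"] zero_le_power2[of w] w by (simp add: power2_eq_square algebra_simps)
  have "1 \<le> (1 - w + w\<^sup>2) * (1 + w + w\<^sup>2 / 2)"
  proof -
    have "(1 - w + w\<^sup>2) * (1 + w + w\<^sup>2 / 2) = 1 + w^2/2 + w^3/2 + w^4/2"
      by (simp add: field_simps eval_nat_numeral)
    then show ?thesis using w by simp
  qed
  also have "\<dots> \<le> (1 - w + w\<^sup>2) * exp w" using e q by (intro mult_left_mono)
  finally have "exp (- w) \<le> 1 - w + w\<^sup>2"
    by (simp add: exp_minus field_simps)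
  moreover have "z\<^sup>2 \<le> z\<^sup>2 * exp B" using assms(2) by (simp add: mult_le_cancel_left1)
  ultimately show ?thesis by (simp add: w_def)
qed

lemma prob_space_iid: "prob_space N \<Longrightarrow> prob_space (iid N)"
  unfolding iid_def by (rule prob_space_PiM)

lemma measurable_iid_coord:
  assumes "f \<in> measurable N K"
  shows "(\<lambda>\<omega>. f (\<omega> (j::nat))) \<in> measurable (iid N) K"
  unfolding iid_def by (rule measurable_compose[OF measurable_component_singleton[of j UNIV "\<lambda>_. N"] assms]) simp

lemma measurable_case_nat_iid:
  "(\<lambda>(s, \<omega>). case_nat s \<omega>) \<in> measurable (N \<Otimes>\<^sub>M iid N) (iid N)"
  unfolding iid_def by measurable

text \<open>
  An i.i.d. sequence with an independent coordinate put in front has the same law. Integrals over the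
  sequence space can therefore be computed one coordinate at a time, and what follows about sums of
  samples is proved by induction through this identity.
\<close>

lemma distr_case_nat_iid:
  assumes "prob_space N"
  shows "distr (N \<Otimes>\<^sub>M iid N) (iid N) (\<lambda>(s, \<omega>). case_nat s \<omega>) = iid N"
proof -
  interpret N: prob_space N by fact
  interpret product_prob_space "\<lambda>_::nat. N" UNIV by unfold_locales
  interpret sequence_space N by unfold_locales
  show ?thesis unfolding iid_def by (rule PiM_iter)
qed

lemma nn_integral_iid_split:
  assumes N: "prob_space N" and F: "F \<in> borel_measurable (iid N)"
  shows "(\<integral>\<^sup>+\<omega>. F \<omega> \<partial>iid N) = (\<integral>\<^sup>+x. (\<integral>\<^sup>+\<omega>. F (case_nat x \<omega>) \<partial>iid N) \<partial>N)"
proof -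
  interpret Q: prob_space "iid N" using prob_space_iid[OF N] .
  have "(\<integral>\<^sup>+\<omega>. F \<omega> \<partial>iid N) = (\<integral>\<^sup>+\<omega>. F \<omega> \<partial>distr (N \<Otimes>\<^sub>M iid N) (iid N) (\<lambda>(s, \<omega>). case_nat s \<omega>))"
    using distr_case_nat_iid[OF N] by simp
  also have "\<dots> = (\<integral>\<^sup>+p. F ((\<lambda>(s, \<omega>). case_nat s \<omega>) p) \<partial>(N \<Otimes>\<^sub>M iid N))"
    by (rule nn_integral_distr[OF measurable_case_nat_iid]) (simp add: F)
  also have "\<dots> = (\<integral>\<^sup>+x. (\<integral>\<^sup>+\<omega>. F (case_nat x \<omega>) \<partial>iid N) \<partial>N)"
    using Q.nn_integral_fst[OF measurable_compose[OF measurable_case_nat_iid F], symmetric] by simp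
  finally show ?thesis .
qed

lemma nn_integral_iid_prod:
  assumes N: "prob_space N" and h: "h \<in> borel_measurable N"
  shows "(\<integral>\<^sup>+\<omega>. (\<Prod>j<n. h (\<omega> j)) \<partial>iid N) = (\<integral>\<^sup>+x. h x \<partial>N) ^ n"
proof (induction n)
  case 0
  interpret Q: prob_space "iid N" using prob_space_iid[OF N] .
  show ?case by (simp add: Q.emeasure_space_1)
next
  case (Suc n)
  have m: "(\<lambda>\<omega>. h (\<omega> j)) \<in> borel_measurable (iid N)" for j :: nat
    using measurable_iid_coord[OF h] .
  have "(\<integral>\<^sup>+\<omega>. (\<Prod>j<Suc n. h (\<omega> j)) \<partial>iid N)
      = (\<integral>\<^sup>+x. (\<integral>\<^sup>+\<omega>. h x * (\<Prod>j<n. h (\<omega> j)) \<partial>iid N) \<partial>N)"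
    using m by (subst nn_integral_iid_split[OF N])
      (auto simp: prod.lessThan_Suc_shift simp del: prod.lessThan_Suc intro!: borel_measurable_prod)
  also have "\<dots> = (\<integral>\<^sup>+x. h x * (\<integral>\<^sup>+x. h x \<partial>N) ^ n \<partial>N)"
    using m Suc by (subst nn_integral_cmult) (auto intro!: borel_measurable_prod)
  also have "\<dots> = (\<integral>\<^sup>+x. h x \<partial>N) ^ Suc n"
    using h by (subst nn_integral_multc) auto
  finally show ?case .
qed

lemma distr_coord_iid:
  assumes "prob_space N"
  shows "distr (iid N) N (\<lambda>\<omega>. \<omega> j) = N"
proof -
  interpret N: prob_space N by fact
  interpret product_prob_space "\<lambda>_::nat. N" UNIV by unfold_locales
  show ?thesis unfolding iid_def by (rule PiM_component) simp
qed

lemma integral_iid_coord: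
  assumes "prob_space N" "f \<in> borel_measurable N"
  shows "(LINT \<omega>|iid N. f (\<omega> j)) = (LINT x|N. (f x :: real))"
  by (subst (2) distr_coord_iid[OF assms(1), of j, symmetric], subst integral_distr)
    (auto simp: assms measurable_iid_coord[where f="\<lambda>x. x", simplified])

lemma integrable_iid_coord:
  assumes "prob_space N" "integrable N (f::_\<Rightarrow>real)"
  shows "integrable (iid N) (\<lambda>\<omega>. f (\<omega> j))"
proof -
  have "integrable (distr (iid N) N (\<lambda>\<omega>. \<omega> j)) f"
    using assms by (simp add: distr_coord_iid)
  then show ?thesis
    by (subst (asm) integrable_distr_eq)
      (use assms in \<open>auto intro: measurable_iid_coord[where f="\<lambda>x. x", simplified] \<close>)
qed

lemma prob_iid_coord:
  assumes "prob_space N" "A \<in> sets N"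
  shows "measure (iid N) {\<omega> \<in> space (iid N). \<omega> j \<in> A} = measure N A"
proof -
  have "measure N A = measure (distr (iid N) N (\<lambda>\<omega>. \<omega> j)) A"
    using assms by (simp add: distr_coord_iid)
  also have "\<dots> = measure (iid N) ((\<lambda>\<omega>. \<omega> j) -` A \<inter> space (iid N))"
    by (rule measure_distr) (use assms in \<open>auto intro: measurable_iid_coord[where f="\<lambda>x. x", simplified] \<close>)
  finally show ?thesis by (simp add: vimage_def Int_def conj_commute)
qed

text \<open>
  For fixed first coordinate, the integral over the remaining ones is a quadratic polynomial in
  \<open>g x\<close> whose linear term vanishes because \<open>g\<close> is centred.
\<close>

lemma second_moment_iid_sum:
  assumes N: "prob_space N" and g: "integrable N g" "(LINT x|N. g x) = (0::real)"
    and g2: "integrable N (\<lambda>x. (g x)\<^sup>2)"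
  shows "integrable (iid N) (\<lambda>\<omega>. (\<Sum>j<n. g (\<omega> j))\<^sup>2)
    \<and> (LINT \<omega>|iid N. (\<Sum>j<n. g (\<omega> j))\<^sup>2) = n * (LINT x|N. (g x)\<^sup>2)"
proof (induction n)
  case 0
  show ?case by simp
next
  case (Suc n)
  interpret N: prob_space N by fact
  interpret Q: prob_space "iid N" using prob_space_iid[OF N] .
  define V where "V = (LINT x|N. (g x)\<^sup>2)"
  have V: "V \<ge> 0" by (simp add: V_def)
  have [measurable]: "g \<in> borel_measurable N" using g by auto
  have m[measurable]: "(\<lambda>\<omega>. g (\<omega> j)) \<in> borel_measurable (iid N)" for j :: nat
    by (rule measurable_iid_coord) measurable
  have i: "integrable (iid N) (\<lambda>\<omega>. g (\<omega> j))" for j :: nat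
    by (rule integrable_iid_coord[OF N g(1)])
  let ?S = "\<lambda>\<omega>. \<Sum>j<n. g (\<omega> j)"
  have iS: "integrable (iid N) ?S" using i by auto
  have eS: "(LINT \<omega>|iid N. ?S \<omega>) = 0"
    using i g(2) by (subst Bochner_Integration.integral_sum) (auto simp: integral_iid_coord[OF N])
  have inner: "(\<integral>\<^sup>+\<omega>. ennreal ((g x + ?S \<omega>)\<^sup>2) \<partial>iid N) = ennreal ((g x)\<^sup>2 + n * V)" for x
  proof -
    have eq: "(\<lambda>\<omega>. (g x + ?S \<omega>)\<^sup>2) = (\<lambda>\<omega>. (g x)\<^sup>2 + (2 * g x * ?S \<omega> + (?S \<omega>)\<^sup>2))"
      by (simp add: power2_sum algebra_simps)
    have int: "integrable (iid N) (\<lambda>\<omega>. (g x + ?S \<omega>)\<^sup>2)"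
      unfolding eq using Suc iS by (intro Bochner_Integration.integrable_add) auto
    have "(LINT \<omega>|iid N. (g x + ?S \<omega>)\<^sup>2) = (g x)\<^sup>2 + n * V"
      unfolding eq using Suc iS eS
      by (subst Bochner_Integration.integral_add, (auto simp: Q.prob_space V_def)[2])+ 
         (auto simp: Q.prob_space V_def)
    then show ?thesis
      using int by (subst nn_integral_eq_integral) auto
  qed
  have "(\<integral>\<^sup>+\<omega>. ennreal ((\<Sum>j<Suc n. g (\<omega> j))\<^sup>2) \<partial>iid N)
      = (\<integral>\<^sup>+x. (\<integral>\<^sup>+\<omega>. ennreal ((g x + ?S \<omega>)\<^sup>2) \<partial>iid N) \<partial>N)"
    by (subst nn_integral_iid_split[OF N]) (auto simp: sum.lessThan_Suc_shift simp del: sum.lessThan_Suc)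
  also have "\<dots> = (\<integral>\<^sup>+x. ennreal ((g x)\<^sup>2 + n * V) \<partial>N)"
    by (simp only: inner)
  also have "\<dots> = ennreal (Suc n * V)"
    using g2 V by (subst nn_integral_eq_integral) (auto simp: N.prob_space V_def algebra_simps)
  finally have *: "(\<integral>\<^sup>+\<omega>. ennreal ((\<Sum>j<Suc n. g (\<omega> j))\<^sup>2) \<partial>iid N) = ennreal (Suc n * V)" .
  have int: "integrable (iid N) (\<lambda>\<omega>. (\<Sum>j<Suc n. g (\<omega> j))\<^sup>2)"
    by (rule integrableI_nn_integral_finite[OF _ _ *]) auto
  moreover have "(LINT \<omega>|iid N. (\<Sum>j<Suc n. g (\<omega> j))\<^sup>2) = Suc n * V"
    by (rule integral_eq_nn_integral[THEN trans]) (use * V in auto)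
  ultimately show ?case by (simp add: V_def)
qed

lemma weak_law_iid:
  assumes N: "prob_space N" and f[measurable]: "f \<in> borel_measurable N"
    and f2: "integrable N (\<lambda>x. (f x)\<^sup>2)" and e: "\<eta> > (0::real)"
  shows "(\<lambda>n. measure (iid N) {\<omega> \<in> space (iid N).
      real n * \<eta> \<le> \<bar>(\<Sum>j<n. f (\<omega> j)) - real n * (LINT x|N. f x)\<bar>}) \<longlonglongrightarrow> 0"
proof -
  interpret N: prob_space N by fact
  interpret Q: prob_space "iid N" using prob_space_iid[OF N] .
  define \<mu> where "\<mu> = (LINT x|N. f x)"
  define g where "g x = f x - \<mu>" for x
  have fi: "integrable N f" using N.square_integrable_imp_integrable[OF f f2] .
  have gm[measurable]: "g \<in> borel_measurable N" unfolding g_def by measurable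
  have m[measurable]: "(\<lambda>\<omega>. g (\<omega> j)) \<in> borel_measurable (iid N)" for j :: nat
    by (rule measurable_iid_coord) measurable
  have g1: "integrable N g" "(LINT x|N. g x) = 0"
    using fi by (auto simp: g_def[abs_def] \<mu>_def N.prob_space)
  have g2: "integrable N (\<lambda>x. (g x)\<^sup>2)"
    using fi f2 by (auto simp: g_def[abs_def] power2_diff)
  define V where "V = (LINT x|N. (g x)\<^sup>2)"
  have bd: "measure (iid N) {\<omega> \<in> space (iid N). n * \<eta> \<le> \<bar>(\<Sum>j<n. f (\<omega> j)) - n * \<mu>\<bar>} \<le> V / (\<eta>\<^sup>2 * n)"
    if n: "n \<ge> 1" for n :: nat
  proof -
    have "measure (iid N) {\<omega> \<in> space (iid N). \<bar>\<Sum>j<n. g (\<omega> j)\<bar> \<ge> n * \<eta>}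
      \<le> (LINT \<omega>|iid N. (\<Sum>j<n. g (\<omega> j))\<^sup>2) / (n * \<eta>)\<^sup>2"
      using second_moment_iid_sum[OF N g1 g2, of n] n e
      by (intro Q.second_moment_method) auto
    also have "\<dots> = V / (\<eta>\<^sup>2 * n)"
      using second_moment_iid_sum[OF N g1 g2, of n] n by (simp add: V_def power2_eq_square)
    finally show ?thesis by (simp add: g_def sum_subtractf)
  qed
  have "(\<lambda>n. V / (\<eta>\<^sup>2 * real n)) \<longlonglongrightarrow> 0"
    using e by real_asymp
  then show ?thesis unfolding \<mu>_def[symmetric]
    by (rule tendsto_sandwich[OF _ _ tendsto_const, rotated 2])
       (auto intro!: eventually_mono[OF eventually_ge_at_top[of 1]] bd)
qed

section \<open>One big jump under a stretched-exponential tail\<close>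

text \<open>
  A variable \<open>f k\<close> with \<open>P(f k > t) = exp (- (c + o(1)) t^\<gamma>)\<close>: the upper half of this asymptotic is
  the exponential moment condition \<open>tail_upper\<close>, the lower half is \<open>tail_lower\<close>. The other observables
  are negligible against \<open>f k\<close>.
\<close>

locale big_jump = N: prob_space N for N :: "real measure" +
  fixes k :: nat and f :: "nat \<Rightarrow> real \<Rightarrow> real" and \<gamma> c :: real
  assumes k1: "k \<ge> 1"
    and f_meas[measurable]: "\<And>i. i \<in> {1..k} \<Longrightarrow> f i \<in> borel_measurable N"
    and f_pos: "\<And>i x. i \<in> {1..k} \<Longrightarrow> x \<in> space N \<Longrightarrow> 0 < f i x"
    and f_square: "\<And>i. i \<in> {1..k} \<Longrightarrow> integrable N (\<lambda>x. (f i x)\<^sup>2)"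
    and f_small: "\<And>i \<eta>. i \<in> {1..k - 1} \<Longrightarrow> \<eta> > 0 \<Longrightarrow> \<exists>A. \<forall>x\<in>space N. f i x \<le> A + \<eta> * f k x"
    and g_range: "0 < \<gamma>" "\<gamma> < 1" and c_pos: "0 < c"
    and tail_upper: "\<And>c'. 0 < c' \<Longrightarrow> c' < c \<Longrightarrow>
      integrable N (\<lambda>x. (f k x)\<^sup>2 * exp (c' * f k x powr \<gamma>))"
    and tail_lower: "\<And>c' \<alpha> \<beta>. c < c' \<Longrightarrow> 0 < \<alpha> \<Longrightarrow> \<alpha> < \<beta> \<Longrightarrow> \<forall>\<^sub>F n in sequentially.
      exp (- c' * (real n * \<beta>) powr \<gamma>)
        \<le> measure N {x \<in> space N. real n * \<alpha> \<le> f k x \<and> f k x \<le> real n * \<beta>}"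
begin

abbreviation "Y \<equiv> f k"
abbreviation "G \<equiv> (LINT x|N. f k x)"
abbreviation "Q \<equiv> iid N"

lemma Y_meas[measurable]: "Y \<in> borel_measurable N" using k1 by auto
lemma Y_pos: "x \<in> space N \<Longrightarrow> 0 < Y x" using k1 f_pos by auto
lemma f_int: "i \<in> {1..k} \<Longrightarrow> integrable N (f i)"
  using N.square_integrable_imp_integrable[OF f_meas f_square] .
lemma Y_int: "integrable N Y" using f_int k1 by auto
lemma coord_meas[measurable]: "i \<in> {1..k} \<Longrightarrow> (\<lambda>\<omega>. f i (\<omega> j)) \<in> borel_measurable Q" for j :: nat
  by (rule measurable_iid_coord) measurable
lemma Y_coord_meas[measurable]: "(\<lambda>\<omega>. Y (\<omega> j)) \<in> borel_measurable Q" for j :: nat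
  by (rule measurable_iid_coord) measurable
lemma space_Q: "\<omega> \<in> space Q \<Longrightarrow> \<omega> j \<in> space N"
  by (auto simp: iid_def space_PiM)
lemma Q_prob: "prob_space Q" by (rule prob_space_iid) (rule N.prob_space_axioms)

text \<open>
  The square makes room for the quadratic remainder in the exponential moment estimate.
\<close>

definition tail_moment :: "real \<Rightarrow> real"
  where "tail_moment c' = (LINT x|N. (Y x)\<^sup>2 * exp (c' * Y x powr \<gamma>))"

lemma tail_moment_nonneg: "0 \<le> tail_moment c'"
  unfolding tail_moment_def by (intro integral_nonneg_AE) auto

text \<open>
  The slope \<open>s = c' * T^(\<gamma> - 1)\<close> is the largest one for which \<open>s * y \<le> c' * y^\<gamma>\<close> on all of \<open>(0, T]\<close>;
  the two sides agree at \<open>y = T\<close>. With it, the exponential moment of the variable truncated at \<open>T\<close> is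
  controlled by \<open>tail_moment c'\<close>, whatever \<open>T\<close>.
\<close>

lemma truncated_chernoff:
  assumes c': "0 < c'" "c' < c" and T: "0 < T"
  defines "s \<equiv> c' * T powr (\<gamma> - 1)"
  shows "measure Q {\<omega> \<in> space Q. (\<forall>j<n. Y (\<omega> j) \<le> T) \<and> r \<le> (\<Sum>j<n. Y (\<omega> j))}
    \<le> exp (- s * r + n * (s * G + s\<^sup>2 * tail_moment c'))"
proof -
  interpret Q: prob_space Q by (rule Q_prob)
  define K where "K = tail_moment c'"
  define h where "h x = (if Y x \<le> T then exp (s * Y x) else 0)" for x
  have s: "s > 0" using c' T by (simp add: s_def)
  have hm[measurable]: "h \<in> borel_measurable N" unfolding h_def by measurable
  have hcm[measurable]: "(\<lambda>\<omega>. h (\<omega> j)) \<in> borel_measurable Q" for j :: nat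
    by (rule measurable_iid_coord) measurable
  have h0: "0 \<le> h x" for x by (simp add: h_def)
  have G0: "0 \<le> G" by (intro integral_nonneg_AE) (auto simp: Y_pos less_imp_le)
  have hle: "h x \<le> 1 + s * Y x + s\<^sup>2 * ((Y x)\<^sup>2 * exp (c' * Y x powr \<gamma>))" if x: "x \<in> space N" for x
  proof (cases "Y x \<le> T")
    case True
    have y: "0 < Y x" using Y_pos[OF x] .
    have "T powr (\<gamma> - 1) \<le> Y x powr (\<gamma> - 1)"
      using True y g_range by (intro powr_mono2') auto
    then have "s * Y x \<le> c' * Y x powr (\<gamma> - 1) * Y x"
      unfolding s_def using y c' by (intro mult_right_mono mult_left_mono) auto
    also have "\<dots> = c' * Y x powr \<gamma>" using y by (simp add: powr_diff)
    finally have "s * Y x \<le> c' * Y x powr \<gamma>" .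
    from exp_le_quadratic[OF this] c' True show ?thesis
      by (simp add: h_def power_mult_distrib mult.assoc)
  next
    case False
    then show ?thesis using Y_pos[OF x] s by (simp add: h_def add_nonneg_nonneg)
  qed
  have "(\<integral>\<^sup>+x. ennreal (h x) \<partial>N)
      \<le> (\<integral>\<^sup>+x. ennreal (1 + s * Y x + s\<^sup>2 * ((Y x)\<^sup>2 * exp (c' * Y x powr \<gamma>))) \<partial>N)"
    by (intro nn_integral_mono ennreal_leI hle)
  also have "\<dots> = ennreal (LINT x|N. 1 + s * Y x + s\<^sup>2 * ((Y x)\<^sup>2 * exp (c' * Y x powr \<gamma>)))"
    using tail_upper[OF c'] Y_int s Y_pos
    by (intro nn_integral_eq_integral) (auto intro!: AE_I2 add_nonneg_nonneg simp: less_imp_le)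
  also have "(LINT x|N. 1 + s * Y x + s\<^sup>2 * ((Y x)\<^sup>2 * exp (c' * Y x powr \<gamma>))) = 1 + (s * G + s\<^sup>2 * K)"
    using tail_upper[OF c'] Y_int by (simp add: N.prob_space K_def tail_moment_def)
  also have "\<dots> \<le> exp (s * G + s\<^sup>2 * K)" by (rule exp_ge_add_one_self)
  finally have hI: "(\<integral>\<^sup>+x. ennreal (h x) \<partial>N) \<le> ennreal (exp (s * G + s\<^sup>2 * K))"
    by (simp add: ennreal_leI)
  let ?E = "{\<omega> \<in> space Q. (\<forall>j<n. Y (\<omega> j) \<le> T) \<and> r \<le> (\<Sum>j<n. Y (\<omega> j))}"
  have E: "?E \<in> sets Q" by measurable
  have "emeasure Q ?E = (\<integral>\<^sup>+\<omega>. indicator ?E \<omega> \<partial>Q)" using E by simp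
  also have "\<dots> \<le> (\<integral>\<^sup>+\<omega>. ennreal (exp (- s * r)) * (\<Prod>j<n. ennreal (h (\<omega> j))) \<partial>Q)"
  proof (intro nn_integral_mono)
    fix \<omega>
    show "indicator ?E \<omega> \<le> ennreal (exp (- s * r)) * (\<Prod>j<n. ennreal (h (\<omega> j)))"
    proof (cases "\<omega> \<in> ?E")
      case True
      have "(\<Prod>j<n. h (\<omega> j)) = exp (s * (\<Sum>j<n. Y (\<omega> j)))"
        using True by (simp add: h_def exp_sum sum_distrib_left)
      moreover have "s * r \<le> s * (\<Sum>j<n. Y (\<omega> j))"
        using True s by (intro mult_left_mono) auto
      ultimately have "1 \<le> exp (- s * r) * (\<Prod>j<n. h (\<omega> j))"
        by (simp flip: exp_add)
      then show ?thesis using True h0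
        by (simp add: prod_ennreal ennreal_mult[symmetric] prod_nonneg)
    qed simp
  qed
  also have "\<dots> = ennreal (exp (- s * r)) * (\<integral>\<^sup>+x. ennreal (h x) \<partial>N) ^ n"
    by (subst nn_integral_cmult) (auto simp: nn_integral_iid_prod[OF N.prob_space_axioms, where h="\<lambda>x. ennreal (h x)"]
        intro!: borel_measurable_prod)
  also have "\<dots> \<le> ennreal (exp (- s * r)) * ennreal (exp (s * G + s\<^sup>2 * K)) ^ n"
    by (intro mult_left_mono power_mono hI) auto
  also have "\<dots> = ennreal (exp (- s * r + n * (s * G + s\<^sup>2 * K)))"
    by (simp add: ennreal_power ennreal_mult[symmetric] exp_of_nat_mult[symmetric] exp_add[symmetric])
  finally show ?thesis
    by (simp add: Q.emeasure_eq_measure K_def)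
qed

lemma tail_bound:
  assumes c': "0 < c'" "c' < c" and t: "1 \<le> t"
  shows "measure N {x \<in> space N. t \<le> Y x} \<le> tail_moment c' * exp (- c' * t powr \<gamma>)"
proof -
  let ?g = "\<lambda>x. (Y x)\<^sup>2 * exp (c' * Y x powr \<gamma>)"
  have le: "exp (c' * t powr \<gamma>) \<le> ?g x" if "t \<le> Y x" for x
  proof -
    have "exp (c' * t powr \<gamma>) \<le> exp (c' * Y x powr \<gamma>)"
      using that t c' g_range by (auto intro!: powr_mono2)
    also have "\<dots> \<le> ?g x" using that t by (simp add: mult_le_cancel_right1)
    finally show ?thesis .
  qed
  have "measure N {x \<in> space N. t \<le> Y x} \<le> measure N {x \<in> space N. exp (c' * t powr \<gamma>) \<le> ?g x}"
    using le by (intro N.finite_measure_mono) auto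
  also have "\<dots> \<le> (LINT x|N. ?g x) / exp (c' * t powr \<gamma>)"
    by (rule integral_Markov_inequality_measure[where A="{}"]) (use tail_upper[OF c'] in auto)
  finally show ?thesis by (simp add: tail_moment_def exp_minus field_simps)
qed

lemma max_tail_bound:
  assumes c': "0 < c'" "c' < c" and t: "1 \<le> t"
  shows "measure Q {\<omega> \<in> space Q. \<exists>j<n. t \<le> Y (\<omega> j)} \<le> real n * (tail_moment c' * exp (- c' * t powr \<gamma>))"
proof -
  interpret Q: prob_space Q by (rule Q_prob)
  have eq: "{\<omega> \<in> space Q. \<exists>j<n. t \<le> Y (\<omega> j)}
    = (\<Union>j<n. {\<omega> \<in> space Q. \<omega> j \<in> {x \<in> space N. t \<le> Y x}})"
    using space_Q by auto
  have "measure Q {\<omega> \<in> space Q. \<exists>j<n. t \<le> Y (\<omega> j)}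
    \<le> (\<Sum>j<n. measure Q {\<omega> \<in> space Q. \<omega> j \<in> {x \<in> space N. t \<le> Y x}})"
    unfolding eq
    by (intro Q.finite_measure_subadditive_finite) (auto simp: space_Q cong: conj_cong)
  also have "\<dots> = (\<Sum>j<n. measure N {x \<in> space N. t \<le> Y x})"
    by (intro sum.cong refl prob_iid_coord[OF N.prob_space_axioms]) simp
  also have "\<dots> \<le> n * (tail_moment c' * exp (- c' * t powr \<gamma>))"
    using tail_bound[OF assms] by (simp add: mult_left_mono)
  finally show ?thesis .
qed

end

lemma near_iff:
  assumes "n \<ge> 1"
  shows "near k f a \<delta> n \<omega> \<longleftrightarrow> (\<forall>i\<in>{1..k}. \<bar>(\<Sum>j<n. f i (\<omega> j)) - real n * a i\<bar> \<le> real n * \<delta>)"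
proof -
  have "\<bar>S / real n - x\<bar> \<le> \<delta> \<longleftrightarrow> \<bar>S - real n * x\<bar> \<le> real n * \<delta>" for S x
  proof -
    have "S / real n - x = (S - real n * x) / real n"
      using assms by (simp add: field_simps)
    then have "\<bar>S / real n - x\<bar> = \<bar>S - real n * x\<bar> / real n" by simp
    then show ?thesis using assms by (simp add: divide_le_eq mult.commute)
  qed
  then show ?thesis by (simp add: near_def emp_mean_def)
qed

lemma max_share_less_iff:
  assumes "n \<ge> 1"
  shows "max_share f n \<omega> < t \<longleftrightarrow> (\<forall>j<n. f (\<omega> j) < real n * t)"
  unfolding max_share_def using assms
  by (subst Max_less_iff) (auto simp: divide_less_eq mult.commute lessThan_empty_iff)

text \<open>
  Localization rests on a strict inequality \<open>R > 1\<close> between the costs of two scenarios. This lemma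
  provides the room \<open>\<tau>\<close> for replacing \<open>c\<close> by \<open>c * (1 - \<tau>)\<close> in the upper bounds, by \<open>c * (1 + \<tau>)\<close> in
  the lower bound, and the excess \<open>b\<close> by \<open>b * (1 - \<tau>)\<close>.
\<close>

lemma exists_margin:
  fixes R :: real
  assumes "R > 1"
  shows "\<exists>\<tau>>0. \<tau> < 1 \<and> 1 + \<tau> < (1 - \<tau>)\<^sup>2 * R"
proof (intro exI conjI)
  let ?t = "(R - 1) / (2 * (2 * R + 1))"
  show t: "0 < ?t" "?t < 1" using assms by (auto simp: field_simps)
  have "?t * (2 * R + 1) = (R - 1) / 2"
    using assms by (simp add: divide_simps) 
  then have "1 + ?t < (1 - 2 * ?t) * R"
    using assms by argo
  also have "\<dots> \<le> (1 - ?t)\<^sup>2 * R"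
    using assms by (intro mult_right_mono) (auto simp: power2_diff)
  finally show "1 + ?t < (1 - ?t)\<^sup>2 * R" .
qed

lemma elog_le_of_le_exp:
  assumes "p \<le> exp t"
  shows "elog (ennreal p) \<le> ereal t"
proof (cases "p \<le> 0")
  case True
  then show ?thesis by (simp add: elog_def ennreal_neg)
next
  case False
  then have "ln p \<le> ln (exp t)" using assms by (subst ln_le_cancel_iff) auto
  then show ?thesis using False by (simp add: elog_def)
qed

context big_jump
begin

context
  fixes a :: "nat \<Rightarrow> real" and b :: real
  assumes a_mean: "\<And>i. i \<in> {1..k - 1} \<Longrightarrow> a i = (LINT x|N. f i x)"
    and a_excess: "a k = G + b" and b: "b > 0"
begin

lemma near_meas[measurable]: "{\<omega> \<in> space Q. near k f a \<delta> n \<omega>} \<in> sets Q"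
proof -
  have [measurable]: "(\<lambda>\<omega>. emp_mean (f i) n \<omega>) \<in> borel_measurable Q" if "i \<in> {1..k}" for i
    unfolding emp_mean_def using that by measurable
  show ?thesis unfolding near_def by measurable
qed

lemma share_meas[measurable]: "(\<lambda>\<omega>. max_share Y n \<omega>) \<in> borel_measurable Q"
  unfolding max_share_def by measurable

lemma typical_bulk:
  assumes "\<eta> > 0"
  shows "\<forall>\<^sub>F n in sequentially. 1 / 2 \<le> measure Q {\<omega> \<in> space Q.
    \<forall>i\<in>{1..k}. \<bar>(\<Sum>j<n. f i (\<omega> j)) - real n * (LINT x|N. f i x)\<bar> < real n * \<eta>}"
proof -
  interpret Q: prob_space Q by (rule Q_prob)
  define B where "B i n = {\<omega> \<in> space Q. real n * \<eta> \<le> \<bar>(\<Sum>j<n. f i (\<omega> j)) - real n * (LINT x|N. f i x)\<bar>}"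
    for i n
  have Bm: "B i n \<in> sets Q" if "i \<in> {1..k}" for i n
    unfolding B_def using that by measurable
  have "(\<lambda>n. \<Sum>i\<in>{1..k}. measure Q (B i n)) \<longlonglongrightarrow> (\<Sum>i\<in>{1..k}. 0)"
    unfolding B_def
    by (intro tendsto_sum weak_law_iid N.prob_space_axioms f_meas f_square assms)
  then have "\<forall>\<^sub>F n in sequentially. (\<Sum>i\<in>{1..k}. measure Q (B i n)) < 1 / 2"
    by (rule order_tendstoD) simp
  then show ?thesis
  proof eventually_elim
    case (elim n)
    have "{\<omega> \<in> space Q. \<forall>i\<in>{1..k}. \<bar>(\<Sum>j<n. f i (\<omega> j)) - real n * (LINT x|N. f i x)\<bar> < real n * \<eta>}
      = space Q - (\<Union>i\<in>{1..k}. B i n)"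
      by (auto simp: B_def not_le)
    moreover have "measure Q (\<Union>i\<in>{1..k}. B i n) \<le> (\<Sum>i\<in>{1..k}. measure Q (B i n))"
      using Bm by (intro Q.finite_measure_subadditive_finite) auto
    moreover have "(\<Union>i\<in>{1..k}. B i n) \<in> sets Q"
      using Bm by (intro sets.finite_UN) auto
    ultimately show ?case using elim by (simp add: Q.prob_compl)
  qed
qed

text \<open>
  The first coordinate carries the whole excess: \<open>Y\<close> lies there in \<open>[n * (b - \<delta>1), n * b]\<close>, while the
  others form a typical sample. There \<open>f i \<le> A i + \<eta> * n * b\<close> for \<open>i < k\<close>, a small fraction of \<open>n\<close>, so
  the other means stay within \<open>\<delta>\<close>. The probability \<open>1 / 2\<close> of the typical sample is absorbed by passing
  from \<open>c1\<close> to the larger rate \<open>c''\<close>.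
\<close>

lemma near_lower_bound:
  assumes \<delta>: "\<delta> > 0" and c'': "c < c''"
  shows "\<forall>\<^sub>F n in sequentially. exp (- c'' * (real n * b) powr \<gamma>) \<le> measure Q {\<omega> \<in> space Q. near k f a \<delta> n \<omega>}"
proof -
  interpret Q: prob_space Q by (rule Q_prob)
  define c1 where "c1 = (c + c'') / 2"
  \<comment> \<open>\<open>b / 2\<close> keeps the lower end \<open>b - \<delta>1\<close> of the jump positive\<close>
  define \<delta>1 where "\<delta>1 = min (\<delta> / 4) (b / 2)"
  have c1: "c < c1" "c1 < c''" using c'' by (auto simp: c1_def)
  have d1: "0 < \<delta>1" "\<delta>1 \<le> \<delta> / 4" "\<delta>1 < b" using \<delta> b by (auto simp: \<delta>1_def)
  \<comment> \<open>a jump of size \<open>n * b\<close> then contributes at most \<open>n * \<delta> / 8\<close> to the other sums, up to a constant\<close>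
  define \<eta> where "\<eta> = \<delta> / (8 * b)"
  have \<eta>: "\<eta> > 0" "\<eta> * b = \<delta> / 8" using \<delta> b by (auto simp: \<eta>_def)
  obtain A where A: "\<And>i x. i \<in> {1..k - 1} \<Longrightarrow> x \<in> space N \<Longrightarrow> f i x \<le> A i + \<eta> * Y x"
    using f_small[OF _ \<eta>(1)] by metis
  define J where "J n = {x \<in> space N. real n * (b - \<delta>1) \<le> Y x \<and> Y x \<le> real n * b}" for n
  define W where "W n = {\<omega> \<in> space Q.
    \<forall>i\<in>{1..k}. \<bar>(\<Sum>j<n. f i (\<omega> j)) - real n * (LINT x|N. f i x)\<bar> < real n * (\<delta> / 4)}" for n
  have Jm[measurable]: "J n \<in> sets N" for n unfolding J_def by measurable
  have Wm[measurable]: "W n \<in> sets Q" for n unfolding W_def by measurable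
  have lin: "filterlim (\<lambda>n. real (Suc n) * t) at_top sequentially" if "t > 0" for t :: real
    using that by real_asymp
  have e1: "\<forall>\<^sub>F n in sequentially. exp (- c1 * (real (Suc n) * b) powr \<gamma>) \<le> measure N (J (Suc n))"
    using tail_lower[OF c1(1), of "b - \<delta>1" b] d1 b
    unfolding J_def by (subst eventually_sequentially_Suc) auto
  have e2: "\<forall>\<^sub>F n in sequentially. 1 / 2 \<le> measure Q (W n)"
    unfolding W_def by (rule typical_bulk) (use \<delta> in simp)
  have e3: "\<forall>\<^sub>F n in sequentially. \<forall>i\<in>{1..k-1}. A i \<le> real (Suc n) * (\<delta> / 8)"
    using lin[of "\<delta> / 8"] \<delta> by (intro eventually_ball_finite ballI) (auto simp: filterlim_at_top)
  have e4: "\<forall>\<^sub>F n in sequentially. \<forall>i\<in>{1..k}. \<bar>LINT x|N. f i x\<bar> \<le> real (Suc n) * (\<delta> / 4)"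
    using lin[of "\<delta> / 4"] \<delta> by (intro eventually_ball_finite ballI) (auto simp: filterlim_at_top)
  have e5: "\<forall>\<^sub>F n in sequentially. ln 2 / (c'' - c1) \<le> (real (Suc n) * b) powr \<gamma>"
  proof -
    have "filterlim (\<lambda>n. (real (Suc n) * b) powr \<gamma>) at_top sequentially"
      using b g_range by real_asymp
    then show ?thesis by (simp add: filterlim_at_top)
  qed
  have "\<forall>\<^sub>F n in sequentially. exp (- c'' * (real (Suc n) * b) powr \<gamma>)
    \<le> measure Q {\<omega> \<in> space Q. near k f a \<delta> (Suc n) \<omega>}"
    using e1 e2 e3 e4 e5
  proof eventually_elim
    case (elim n)
    let ?E = "{\<omega> \<in> space Q. near k f a \<delta> (Suc n) \<omega>}"
    have near: "near k f a \<delta> (Suc n) (case_nat x \<omega>)" if x: "x \<in> J (Suc n)" and w: "\<omega> \<in> W n" for x \<omega>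
    \<comment> \<open>the error is split into the jump, the typical sample, and the one mean missing from that sample\<close>
    proof (subst near_iff, simp, rule ballI)
      fix i assume i: "i \<in> {1..k}"
      let ?m = "LINT x|N. f i x" and ?S = "\<Sum>j<n. f i (\<omega> j)" and ?n = "real (Suc n)"
      have S: "\<bar>?S - real n * ?m\<bar> < real n * (\<delta> / 4)" using w i by (simp add: W_def)
      have n4: "real n * (\<delta> / 4) \<le> ?n * (\<delta> / 4)" using \<delta> by (intro mult_right_mono) auto
      have m: "\<bar>?m\<bar> \<le> ?n * (\<delta> / 4)" using elim(4) i by blast
      have xN: "x \<in> space N" using x by (simp add: J_def)
      have split: "(\<Sum>j<Suc n. f i (case_nat x \<omega> j)) = f i x + ?S"
        by (simp add: sum.lessThan_Suc_shift del: sum.lessThan_Suc)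
      have first: "\<bar>f i x - ?n * (a i - ?m)\<bar> \<le> ?n * (\<delta> / 4)"
      proof (cases "i = k")
        case True
        have "?n * (b - \<delta>1) \<le> Y x" "Y x \<le> ?n * b" using x by (auto simp: J_def)
        moreover have "?n * \<delta>1 \<le> ?n * (\<delta> / 4)" using d1 by (intro mult_left_mono) auto
        ultimately show ?thesis using True a_excess by (simp add: algebra_simps abs_le_iff)
      next
        case False
        then have i': "i \<in> {1..k - 1}" using i by auto
        have "f i x \<le> A i + \<eta> * Y x" using A[OF i' xN] .
        also have "\<dots> \<le> ?n * (\<delta> / 8) + \<eta> * (?n * b)"
          using elim(3) i' x \<eta> by (intro add_mono mult_left_mono) (auto simp: J_def)
        also have "\<dots> = ?n * (\<delta> / 8) + ?n * (\<eta> * b)" by (simp only: ac_simps)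
        also have "\<dots> = ?n * (\<delta> / 4)" unfolding \<eta>(2) by (simp add: field_simps)
        finally show ?thesis using a_mean[OF i'] f_pos[OF i xN] by simp
      qed
      have "(f i x + ?S) - ?n * a i = (f i x - ?n * (a i - ?m)) + (?S - real n * ?m) - ?m"
        by (simp add: algebra_simps)
      then have "\<bar>(f i x + ?S) - ?n * a i\<bar> \<le> 3 * (?n * (\<delta> / 4))"
        using first S n4 m by linarith
      also have "\<dots> \<le> ?n * \<delta>" using \<delta> by (simp add: field_simps)
      finally show "\<bar>(\<Sum>j<Suc n. f i (case_nat x \<omega> j)) - ?n * a i\<bar> \<le> ?n * \<delta>"
        unfolding split .
    qed
    have sp: "case_nat x \<omega> \<in> space Q" if "x \<in> space N" "\<omega> \<in> space Q" for x \<omega>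
      using that by (auto simp: iid_def space_PiM PiE_iff split: nat.split)
    have "emeasure N (J (Suc n)) * emeasure Q (W n)
      = (\<integral>\<^sup>+x. (\<integral>\<^sup>+\<omega>. indicator (J (Suc n)) x * indicator (W n) \<omega> \<partial>Q) \<partial>N)"
      by (simp add: nn_integral_cmult nn_integral_multc)
    also have "\<dots> \<le> (\<integral>\<^sup>+x. (\<integral>\<^sup>+\<omega>. indicator ?E (case_nat x \<omega>) \<partial>Q) \<partial>N)"
      using near sp by (intro nn_integral_mono) (auto split: split_indicator)
    also have "\<dots> = emeasure Q ?E"
      by (subst nn_integral_iid_split[OF N.prob_space_axioms, symmetric]) auto
    finally have JW: "measure N (J (Suc n)) * measure Q (W n) \<le> measure Q ?E"
      by (simp add: N.emeasure_eq_measure Q.emeasure_eq_measure ennreal_mult[symmetric])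
    define z where "z = (real (Suc n) * b) powr \<gamma>"
    have "ln 2 \<le> (c'' - c1) * z"
      using elim(5) c1 by (simp add: z_def divide_le_eq mult.commute)
    then have "exp (- c'' * z) \<le> exp (- c1 * z - ln 2)"
      by (simp add: algebra_simps)
    also have "\<dots> = exp (- c1 * z) * (1 / 2)" by (simp add: exp_diff)
    also have "\<dots> \<le> measure N (J (Suc n)) * measure Q (W n)"
      using elim(1,2) by (intro mult_mono) (auto simp: z_def)
    finally show ?case using JW by (simp add: z_def)
  qed
  then show ?thesis by (subst (asm) eventually_sequentially_Suc)
qed

text \<open>
  By the union bound, some coordinate above \<open>n * (b + \<epsilon>)\<close> has the rate \<open>c * (b + \<epsilon>)^\<gamma>\<close>, which is strictly
  larger than the rate \<open>c * b^\<gamma>\<close> of the conditioning event.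
\<close>

lemma overshoot_unlikely:
  assumes \<delta>: "\<delta> > 0" and e: "\<epsilon> > 0"
  shows "\<exists>\<rho>>0. \<forall>\<^sub>F n in sequentially.
    \<P>(\<omega> in Q. \<not> max_share Y n \<omega> < b + \<epsilon> \<bar> near k f a \<delta> n \<omega>) \<le> exp (- \<rho> * real n powr \<gamma>)"
proof -
  interpret Q: prob_space Q by (rule Q_prob)
  define R where "R = ((b + \<epsilon>) / b) powr \<gamma>"
  have R: "R > 1" unfolding R_def using e b g_range by (intro gr_one_powr) auto
  obtain \<tau> where \<tau>: "0 < \<tau>" "\<tau> < 1" "1 + \<tau> < (1 - \<tau>)\<^sup>2 * R" using exists_margin[OF R] by auto
  have "(1 - \<tau>)\<^sup>2 * R \<le> (1 - \<tau>) * R"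
    using \<tau> R by (intro mult_right_mono) (auto simp: power2_eq_square mult_left_le)
  then have \<tau>R: "1 + \<tau> < (1 - \<tau>) * R" using \<tau> by simp
  define c' where "c' = c * (1 - \<tau>)"
  define c'' where "c'' = c * (1 + \<tau>)"
  have c': "0 < c'" "c' < c" and c'': "c < c''"
    using \<tau> c_pos by (auto simp: c'_def c''_def mult_less_cancel_left1 mult_less_cancel_left2)
  define K where "K = tail_moment c'"
  have K: "K \<ge> 0" by (simp add: K_def tail_moment_nonneg)
  define \<rho> where "\<rho> = c * b powr \<gamma> * ((1 - \<tau>) * R - (1 + \<tau>)) / 2"
  have \<rho>: "\<rho> > 0" using \<tau>R c_pos b by (simp add: \<rho>_def)
  have bR: "(b + \<epsilon>) powr \<gamma> = b powr \<gamma> * R" using b e by (simp add: R_def powr_divide)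
  have gap: "c' * (b + \<epsilon>) powr \<gamma> = c'' * b powr \<gamma> + 2 * \<rho>"
    unfolding bR c'_def c''_def \<rho>_def by (simp add: field_simps)
  have e0: "\<forall>\<^sub>F n::nat in sequentially. real n * K * exp (- \<rho> * real n powr \<gamma>) \<le> 1"
  proof -
    have "(\<lambda>n. real n * K * exp (- \<rho> * real n powr \<gamma>)) \<longlonglongrightarrow> 0"
      using \<rho> g_range by real_asymp
    then show ?thesis by (rule eventually_mono[OF order_tendstoD(2)[of _ _ _ 1]]) auto
  qed
  have e1: "\<forall>\<^sub>F n::nat in sequentially. 1 \<le> real n * (b + \<epsilon>)"
    using b e by real_asymp
  show ?thesis
  proof (intro exI[of _ \<rho>] conjI \<rho>)
    show "\<forall>\<^sub>F n in sequentially.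
      \<P>(\<omega> in Q. \<not> max_share Y n \<omega> < b + \<epsilon> \<bar> near k f a \<delta> n \<omega>) \<le> exp (- \<rho> * real n powr \<gamma>)"
      using near_lower_bound[OF \<delta> c''] e0 e1 eventually_ge_at_top[of 1]
    proof eventually_elim
      case (elim n)
      let ?num = "measure Q {\<omega> \<in> space Q. \<not> max_share Y n \<omega> < b + \<epsilon> \<and> near k f a \<delta> n \<omega>}"
      let ?den = "measure Q {\<omega> \<in> space Q. near k f a \<delta> n \<omega>}"
      define z where "z = real n powr \<gamma>"
      have "?num \<le> measure Q {\<omega> \<in> space Q. \<exists>j<n. real n * (b + \<epsilon>) \<le> Y (\<omega> j)}"
        using elim(4) by (intro Q.finite_measure_mono) (auto simp: max_share_less_iff not_less)
      also have "\<dots> \<le> real n * (K * exp (- c' * (real n * (b + \<epsilon>)) powr \<gamma>))"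
        unfolding K_def by (rule max_tail_bound[OF c' elim(3)])
      also have "c' * (real n * (b + \<epsilon>)) powr \<gamma> = (c'' * b powr \<gamma> + 2 * \<rho>) * z"
        unfolding gap[symmetric] using b e by (simp add: powr_mult z_def)
      then have "real n * (K * exp (- c' * (real n * (b + \<epsilon>)) powr \<gamma>))
        = (real n * K * exp (- \<rho> * z)) * (exp (- \<rho> * z) * exp (- c'' * b powr \<gamma> * z))"
        by (simp add: exp_add[symmetric] algebra_simps)
      also have "\<dots> \<le> 1 * (exp (- \<rho> * z) * exp (- c'' * b powr \<gamma> * z))"
        using elim(2) by (intro mult_right_mono) (auto simp: z_def)
      also have "- c'' * b powr \<gamma> * z = - c'' * (real n * b) powr \<gamma>"
        using b by (simp add: powr_mult z_def)
      also have "1 * (exp (- \<rho> * z) * exp (- c'' * (real n * b) powr \<gamma>)) \<le> exp (- \<rho> * z) * ?den"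
        using elim(1) by simp
      finally have "?num \<le> exp (- \<rho> * z) * ?den" .
      moreover have "0 < ?den" using elim(1) exp_gt_zero less_le_trans by blast
      ultimately show ?case by (simp add: cond_prob_def divide_le_eq z_def)
    qed
  qed
qed

text \<open>
  With \<open>d = b - \<epsilon>\<close> and truncation at \<open>n * d\<close>, the Chernoff rate for an excess of \<open>n * b\<close> is
  \<open>c * b * d^(\<gamma> - 1) = c * b^\<gamma> * (b / d)^(1 - \<gamma>)\<close>, strictly above \<open>c * b^\<gamma>\<close>. The quadratic term of the Chernoff
  bound is of order \<open>n^(2 * \<gamma> - 1)\<close>, which is negligible against \<open>n^\<gamma>\<close> because \<open>\<gamma> < 1\<close>.
\<close>

lemma undershoot_unlikely:
  assumes e: "\<epsilon> > 0"
  shows "\<exists>\<rho>>0. \<exists>\<delta>0>0. \<forall>\<delta>. 0 < \<delta> \<and> \<delta> < \<delta>0 \<longrightarrow> (\<forall>\<^sub>F n in sequentially.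
    \<P>(\<omega> in Q. max_share Y n \<omega> < b - \<epsilon> \<bar> near k f a \<delta> n \<omega>) \<le> exp (- \<rho> * real n powr \<gamma>))"
proof (cases "\<epsilon> < b")
  case False
  have "\<forall>\<^sub>F n in sequentially.
    \<P>(\<omega> in Q. max_share Y n \<omega> < b - \<epsilon> \<bar> near k f a \<delta> n \<omega>) \<le> exp (- 1 * real n powr \<gamma>)" for \<delta>
    using eventually_ge_at_top[of 1]
  proof eventually_elim
    case (elim n)
    have "\<not> max_share Y n \<omega> < b - \<epsilon>" if "\<omega> \<in> space Q" for \<omega>
    proof
      assume "max_share Y n \<omega> < b - \<epsilon>"
      then have "Y (\<omega> 0) < real n * (b - \<epsilon>)" using elim by (simp add: max_share_less_iff)
      moreover have "real n * (b - \<epsilon>) \<le> 0" using False by (simp add: mult_le_0_iff)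
      ultimately show False using Y_pos[OF space_Q[OF that, of 0]] by simp
    qed
    then have "{\<omega> \<in> space Q. max_share Y n \<omega> < b - \<epsilon> \<and> near k f a \<delta> n \<omega>} = {}" by auto
    then show ?case unfolding cond_prob_def by (simp only: measure_empty) simp
  qed
  then show ?thesis by (intro exI[of _ 1]) (auto intro!: exI[of _ 1])
next
  case True
  interpret Q: prob_space Q by (rule Q_prob)
  define d where "d = b - \<epsilon>"
  have d: "0 < d" "d < b" using True e by (auto simp: d_def)
  define R where "R = (b / d) powr (1 - \<gamma>)"
  have R: "R > 1" unfolding R_def using d b g_range by (intro gr_one_powr) auto
  obtain \<tau> where \<tau>: "0 < \<tau>" "\<tau> < 1" "1 + \<tau> < (1 - \<tau>)\<^sup>2 * R" using exists_margin[OF R] by auto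
  define c' where "c' = c * (1 - \<tau>)"
  define c'' where "c'' = c * (1 + \<tau>)"
  have c': "0 < c'" "c' < c" and c'': "c < c''"
    using \<tau> c_pos by (auto simp: c'_def c''_def mult_less_cancel_left1 mult_less_cancel_left2)
  define K where "K = tail_moment c' * (c' * d powr (\<gamma> - 1))\<^sup>2"
  define \<rho> where "\<rho> = c * b powr \<gamma> * ((1 - \<tau>)\<^sup>2 * R - (1 + \<tau>)) / 2"
  have \<rho>: "\<rho> > 0" using \<tau> c_pos b by (simp add: \<rho>_def)
  have Rb: "R * b powr \<gamma> = b * d powr (\<gamma> - 1)"
  proof -
    have "R * b powr \<gamma> = b powr (1 - \<gamma>) * b powr \<gamma> / d powr (1 - \<gamma>)"
      using b d by (simp add: R_def powr_divide)
    also have "b powr (1 - \<gamma>) * b powr \<gamma> = b" using b by (simp flip: powr_add)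
    also have "b / d powr (1 - \<gamma>) = b * d powr (- (1 - \<gamma>))" by (simp only: powr_minus_divide) simp
    finally show ?thesis by simp
  qed
  have gap: "c' * d powr (\<gamma> - 1) * (b * (1 - \<tau>)) = c'' * b powr \<gamma> + 2 * \<rho>"
  proof -
    have "c' * d powr (\<gamma> - 1) * (b * (1 - \<tau>)) = c * (1 - \<tau>)\<^sup>2 * (b * d powr (\<gamma> - 1))"
      by (simp add: c'_def power2_eq_square)
    also have "\<dots> = c'' * b powr \<gamma> + 2 * \<rho>"
      unfolding Rb[symmetric] by (simp add: c''_def \<rho>_def field_simps)
    finally show ?thesis .
  qed
  have e0: "\<forall>\<^sub>F n::nat in sequentially. K * real n powr (\<gamma> - 1) \<le> \<rho>"
  proof -
    have "(\<lambda>n. K * real n powr (\<gamma> - 1)) \<longlonglongrightarrow> 0"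
      using g_range by real_asymp
    then show ?thesis using \<rho> by (rule eventually_mono[OF order_tendstoD(2)]) auto
  qed
  have main: "\<forall>\<^sub>F n in sequentially.
    \<P>(\<omega> in Q. max_share Y n \<omega> < d \<bar> near k f a \<delta> n \<omega>) \<le> exp (- \<rho> * real n powr \<gamma>)"
    if \<delta>: "0 < \<delta>" "\<delta> < \<tau> * b" for \<delta>
    using near_lower_bound[OF \<delta>(1) c''] e0 eventually_ge_at_top[of 1]
  proof eventually_elim
    case (elim n)
    have n: "real n > 0" using elim by simp
    let ?num = "measure Q {\<omega> \<in> space Q. max_share Y n \<omega> < d \<and> near k f a \<delta> n \<omega>}"
    let ?den = "measure Q {\<omega> \<in> space Q. near k f a \<delta> n \<omega>}"
    define z where "z = real n powr \<gamma>"
    define r where "r = real n * (a k - \<delta>)"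
    define s where "s = c' * (real n * d) powr (\<gamma> - 1)"
    have T: "0 < real n * d" using n d by simp
    have "?num \<le> measure Q {\<omega> \<in> space Q. (\<forall>j<n. Y (\<omega> j) \<le> real n * d) \<and> r \<le> (\<Sum>j<n. Y (\<omega> j))}"
    proof (intro Q.finite_measure_mono subsetI)
      fix \<omega> assume w: "\<omega> \<in> {\<omega> \<in> space Q. max_share Y n \<omega> < d \<and> near k f a \<delta> n \<omega>}"
      have "\<bar>(\<Sum>j<n. Y (\<omega> j)) - real n * a k\<bar> \<le> real n * \<delta>"
        using w elim k1 by (auto simp: near_iff)
      then have "r \<le> (\<Sum>j<n. Y (\<omega> j))" by (simp add: r_def algebra_simps abs_le_iff)
      then show "\<omega> \<in> {\<omega> \<in> space Q. (\<forall>j<n. Y (\<omega> j) \<le> real n * d) \<and> r \<le> (\<Sum>j<n. Y (\<omega> j))}"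
        using w elim by (auto simp: max_share_less_iff less_imp_le)
    qed measurable
    also have "\<dots> \<le> exp (- s * r + n * (s * G + s\<^sup>2 * tail_moment c'))"
      unfolding s_def by (rule truncated_chernoff[OF c' T])
    also have "- s * r + n * (s * G + s\<^sup>2 * tail_moment c') = - (s * n) * (b - \<delta>) + n * s\<^sup>2 * tail_moment c'"
      by (simp add: r_def a_excess algebra_simps)
    also have "n * s\<^sup>2 * tail_moment c' = K * real n powr (\<gamma> - 1) * z"
    proof -
      have "s\<^sup>2 = (c' * d powr (\<gamma> - 1))\<^sup>2 * (real n powr (\<gamma> - 1) * real n powr (\<gamma> - 1))"
        using d by (simp add: s_def powr_mult power_mult_distrib power2_eq_square)
      moreover have "n * real n powr (\<gamma> - 1) = z" using n by (simp add: z_def powr_diff)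
      ultimately show ?thesis by (simp add: K_def mult_ac)
    qed
    also have "s * n = c' * d powr (\<gamma> - 1) * z"
      using d n by (simp add: s_def z_def powr_mult powr_diff)
    also have "exp (- (c' * d powr (\<gamma> - 1) * z) * (b - \<delta>) + K * real n powr (\<gamma> - 1) * z)
      \<le> exp (- (c' * d powr (\<gamma> - 1) * z) * (b * (1 - \<tau>)) + \<rho> * z)"
    proof (subst exp_le_cancel_iff, intro add_mono mult_right_mono elim)
      show "0 \<le> z" by (simp add: z_def)
      then have "0 \<le> c' * d powr (\<gamma> - 1) * z" using c' by simp
      moreover have "b * (1 - \<tau>) \<le> b - \<delta>" using \<delta> by (simp add: algebra_simps)
      ultimately show "- (c' * d powr (\<gamma> - 1) * z) * (b - \<delta>) \<le> - (c' * d powr (\<gamma> - 1) * z) * (b * (1 - \<tau>))"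
        by (intro mult_left_mono_neg) auto
    qed
    also have "- (c' * d powr (\<gamma> - 1) * z) * (b * (1 - \<tau>)) + \<rho> * z
      = - z * (c' * d powr (\<gamma> - 1) * (b * (1 - \<tau>))) + \<rho> * z" by (simp add: mult_ac)
    also have "\<dots> = - \<rho> * z + - c'' * (b powr \<gamma> * z)" unfolding gap by (simp add: algebra_simps)
    also have "b powr \<gamma> * z = (real n * b) powr \<gamma>"
      using b by (simp add: powr_mult z_def)
    also have "exp (- \<rho> * z + - c'' * (real n * b) powr \<gamma>) \<le> exp (- \<rho> * z) * ?den"
      unfolding exp_add using elim(1) by (intro mult_left_mono) auto
    finally have "?num \<le> exp (- \<rho> * z) * ?den" .
    moreover have "0 < ?den" using elim(1) exp_gt_zero less_le_trans by blast
    ultimately show ?case by (simp add: cond_prob_def divide_le_eq z_def)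
  qed
  show ?thesis
    by (intro exI[of _ \<rho>] conjI \<rho> exI[of _ "\<tau> * b"]) (use \<tau> b main in \<open>auto simp: d_def\<close>)
qed

text \<open>
  The rate \<open>\<rho>\<close> must not depend on \<open>\<delta>\<close> here: it bounds the outer limit as well.
\<close>

lemma undershoot_rate:
  assumes e: "\<epsilon> > 0"
  shows "Limsup (at_right 0) (\<lambda>\<delta>. limsup (\<lambda>n. ereal (1 / real n powr \<gamma>) *
    elog (ennreal (\<P>(\<omega> in Q. max_share Y n \<omega> < b - \<epsilon> \<bar> near k f a \<delta> n \<omega>))))) < 0"
proof -
  obtain \<rho> \<delta>0 where \<rho>: "\<rho> > 0" and \<delta>0: "\<delta>0 > 0"
    and bd: "\<And>\<delta>. 0 < \<delta> \<Longrightarrow> \<delta> < \<delta>0 \<Longrightarrow> \<forall>\<^sub>F n in sequentially.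
      \<P>(\<omega> in Q. max_share Y n \<omega> < b - \<epsilon> \<bar> near k f a \<delta> n \<omega>) \<le> exp (- \<rho> * real n powr \<gamma>)"
    using undershoot_unlikely[OF e] by blast
  have "limsup (\<lambda>n. ereal (1 / real n powr \<gamma>) *
    elog (ennreal (\<P>(\<omega> in Q. max_share Y n \<omega> < b - \<epsilon> \<bar> near k f a \<delta> n \<omega>)))) \<le> ereal (- \<rho>)"
    if \<delta>: "0 < \<delta>" "\<delta> < \<delta>0" for \<delta>
  proof (rule Limsup_bounded)
    show "\<forall>\<^sub>F n in sequentially. ereal (1 / real n powr \<gamma>) *
      elog (ennreal (\<P>(\<omega> in Q. max_share Y n \<omega> < b - \<epsilon> \<bar> near k f a \<delta> n \<omega>))) \<le> ereal (- \<rho>)"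
      using bd[OF \<delta>] eventually_ge_at_top[of 1]
    proof eventually_elim
      case (elim n)
      let ?p = "\<P>(\<omega> in Q. max_share Y n \<omega> < b - \<epsilon> \<bar> near k f a \<delta> n \<omega>)"
      have "ereal (1 / real n powr \<gamma>) * elog (ennreal ?p) \<le> ereal (1 / real n powr \<gamma>) * ereal (- \<rho> * real n powr \<gamma>)"
        by (intro ereal_mult_left_mono elog_le_of_le_exp elim) auto
      also have "\<dots> = ereal (- \<rho>)" using elim by simp
      finally show ?case .
    qed
  qed
  then have "Limsup (at_right 0) (\<lambda>\<delta>. limsup (\<lambda>n. ereal (1 / real n powr \<gamma>) *
    elog (ennreal (\<P>(\<omega> in Q. max_share Y n \<omega> < b - \<epsilon> \<bar> near k f a \<delta> n \<omega>))))) \<le> ereal (- \<rho>)"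
    using \<delta>0 by (intro Limsup_bounded[where C="ereal (- \<rho>)" and F="at_right 0"] eventually_at_rightI[of 0 \<delta>0]) auto
  also have "\<dots> < 0" using \<rho> by simp
  finally show ?thesis .
qed

lemma localization:
  assumes e: "\<epsilon> > 0"
  shows "\<forall>\<^sub>F \<delta> in at_right 0.
    (\<lambda>n. \<P>(\<omega> in Q. \<bar>max_share Y n \<omega> - b\<bar> < \<epsilon> \<bar> near k f a \<delta> n \<omega>)) \<longlonglongrightarrow> 1"
proof -
  interpret Q: prob_space Q by (rule Q_prob)
  obtain \<rho> \<delta>0 where \<rho>: "\<rho> > 0" and \<delta>0: "\<delta>0 > 0"
    and bd: "\<And>\<delta>. 0 < \<delta> \<Longrightarrow> \<delta> < \<delta>0 \<Longrightarrow> \<forall>\<^sub>F n in sequentially.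
      \<P>(\<omega> in Q. max_share Y n \<omega> < b - \<epsilon> / 2 \<bar> near k f a \<delta> n \<omega>) \<le> exp (- \<rho> * real n powr \<gamma>)"
    using undershoot_unlikely[of "\<epsilon> / 2"] e by auto
  have "(\<lambda>n. \<P>(\<omega> in Q. \<bar>max_share Y n \<omega> - b\<bar> < \<epsilon> \<bar> near k f a \<delta> n \<omega>)) \<longlonglongrightarrow> 1"
    if \<delta>: "0 < \<delta>" "\<delta> < \<delta>0" for \<delta>
  proof -
    obtain \<rho>' where \<rho>': "\<rho>' > 0" and bd': "\<forall>\<^sub>F n in sequentially.
      \<P>(\<omega> in Q. \<not> max_share Y n \<omega> < b + \<epsilon> \<bar> near k f a \<delta> n \<omega>) \<le> exp (- \<rho>' * real n powr \<gamma>)"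
      using overshoot_unlikely[OF \<delta>(1) e] by auto
    have lim: "(\<lambda>n. 1 - exp (- \<rho> * real n powr \<gamma>) - exp (- \<rho>' * real n powr \<gamma>)) \<longlonglongrightarrow> 1"
      using \<rho> \<rho>' g_range by real_asymp
    show ?thesis
    proof (rule tendsto_sandwich[OF _ _ lim tendsto_const])
      show "\<forall>\<^sub>F n in sequentially. 1 - exp (- \<rho> * real n powr \<gamma>) - exp (- \<rho>' * real n powr \<gamma>)
        \<le> \<P>(\<omega> in Q. \<bar>max_share Y n \<omega> - b\<bar> < \<epsilon> \<bar> near k f a \<delta> n \<omega>)"
        using bd[OF \<delta>] bd' near_lower_bound[OF \<delta>(1), of "c + 1", simplified]
      proof eventually_elim
        case (elim n)
        let ?D = "{\<omega> \<in> space Q. near k f a \<delta> n \<omega>}"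
        let ?A = "{\<omega> \<in> space Q. \<bar>max_share Y n \<omega> - b\<bar> < \<epsilon> \<and> near k f a \<delta> n \<omega>}"
        let ?B = "{\<omega> \<in> space Q. max_share Y n \<omega> < b - \<epsilon> / 2 \<and> near k f a \<delta> n \<omega>}"
        let ?C = "{\<omega> \<in> space Q. \<not> max_share Y n \<omega> < b + \<epsilon> \<and> near k f a \<delta> n \<omega>}"
        have D: "0 < measure Q ?D" using elim(3) exp_gt_zero less_le_trans by blast
        have "measure Q ?D \<le> measure Q (?A \<union> (?B \<union> ?C))"
          by (rule Q.finite_measure_mono) (use e in \<open>auto simp: abs_less_iff\<close>)
        also have "\<dots> \<le> measure Q ?A + measure Q (?B \<union> ?C)"
          by (rule measure_Un_le) measurable
        also have "measure Q (?B \<union> ?C) \<le> measure Q ?B + measure Q ?C"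
          by (rule measure_Un_le) measurable
        finally have "measure Q ?D / measure Q ?D
          \<le> (measure Q ?A + (measure Q ?B + measure Q ?C)) / measure Q ?D"
          by (intro divide_right_mono) auto
        then show ?case using elim(1,2) D by (simp add: cond_prob_def add_divide_distrib)
      qed
      show "\<forall>\<^sub>F n in sequentially. \<P>(\<omega> in Q. \<bar>max_share Y n \<omega> - b\<bar> < \<epsilon> \<bar> near k f a \<delta> n \<omega>) \<le> 1"
      proof (intro always_eventually allI)
        fix n
        have "measure Q {\<omega> \<in> space Q. \<bar>max_share Y n \<omega> - b\<bar> < \<epsilon> \<and> near k f a \<delta> n \<omega>}
          \<le> measure Q {\<omega> \<in> space Q. near k f a \<delta> n \<omega>}"
          by (rule Q.finite_measure_mono) auto
        then show "\<P>(\<omega> in Q. \<bar>max_share Y n \<omega> - b\<bar> < \<epsilon> \<bar> near k f a \<delta> n \<omega>) \<le> 1"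
          unfolding cond_prob_def by (intro divide_le_eq_1[THEN iffD2]) (auto simp: less_le)
      qed
    qed
  qed
  then show ?thesis using \<delta>0 by (intro eventually_at_rightI[of 0 \<delta>0]) auto
qed

end

end

section \<open>Gibbs measures on the half-line\<close>

lemma space_pos_lborel[simp]: "space pos_lborel = {0<..}"
  by (simp add: pos_lborel_def space_restrict_space)

lemma emeasure_pos_lborel: "A \<in> sets borel \<Longrightarrow> A \<subseteq> {0<..} \<Longrightarrow> emeasure pos_lborel A = emeasure lborel A"
  by (simp add: pos_lborel_def emeasure_restrict_space)

lemma sets_pos_lborel_I: "A \<in> sets borel \<Longrightarrow> A \<subseteq> {0<..} \<Longrightarrow> A \<in> sets pos_lborel"
  by (auto simp: pos_lborel_def sets_restrict_space image_iff intro!: bexI[of _ A])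

lemma borel_measurable_pos_lborel:
  fixes f :: "real \<Rightarrow> real"
  shows "continuous_on {0<..} f \<Longrightarrow> f \<in> borel_measurable pos_lborel"
  unfolding pos_lborel_def
  by (subst measurable_cong_sets[OF sets_restrict_space_cong[OF sets_lborel] refl])
     (rule borel_measurable_continuous_on_restrict)

definition partition_function :: "(real \<Rightarrow> real) \<Rightarrow> ennreal"
  where "partition_function u = (\<integral>\<^sup>+x. ennreal (exp (u x)) \<partial>pos_lborel)"

lemma sets_gibbs[simp]: "sets (gibbs u) = sets pos_lborel"
  by (simp add: gibbs_def)

lemma space_gibbs[simp]: "space (gibbs u) = {0<..}"
  by (simp add: gibbs_def)

lemma measurable_gibbs[simp]: "measurable (gibbs u) K = measurable pos_lborel K"
  by (rule measurable_cong_sets) simp_all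

lemma partition_function_pos:
  assumes [measurable]: "u \<in> borel_measurable pos_lborel"
  shows "0 < partition_function u"
proof -
  have "partition_function u \<noteq> 0"
  proof
    assume "partition_function u = 0"
    then have "AE x in pos_lborel. ennreal (exp (u x)) = 0"
      unfolding partition_function_def by (subst (asm) nn_integral_0_iff_AE) auto
    then have "AE x in pos_lborel. False" by eventually_elim auto
    then have "emeasure pos_lborel (space pos_lborel) = 0"
      by (simp only: eventually_False ae_filter_eq_bot_iff)
    moreover have "emeasure pos_lborel {0<..<1} \<le> emeasure pos_lborel (space pos_lborel)"
      by (rule emeasure_space)
    ultimately show False by (simp add: emeasure_pos_lborel subset_eq)
  qed
  then show ?thesis by (simp add: zero_less_iff_neq_zero)
qed

lemma gibbs_eq_density:
  assumes [measurable]: "u \<in> borel_measurable pos_lborel" and fin: "partition_function u < \<infinity>"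
  shows "gibbs u = density pos_lborel (\<lambda>x. ennreal (exp (u x) / enn2real (partition_function u)))"
proof -
  have "0 < enn2real (partition_function u)"
    using partition_function_pos[OF assms(1)] fin by (simp add: enn2real_positive_iff)
  then show ?thesis
    unfolding gibbs_def partition_function_def[symmetric]
    using fin by (intro density_cong AE_I2) (auto simp: divide_ennreal[symmetric])
qed

text \<open>
  If the partition function is infinite, the quotient in \<open>gibbs\<close> is \<open>0\<close> everywhere and \<open>gibbs u\<close> is
  the null measure.
\<close>

lemma prob_space_gibbs_iff:
  assumes [measurable]: "u \<in> borel_measurable pos_lborel"
  shows "prob_space (gibbs u) \<longleftrightarrow> partition_function u < \<infinity>"
proof
  assume fin: "partition_function u < \<infinity>"
  show "prob_space (gibbs u)"
  proof
    have "emeasure (gibbs u) (space (gibbs u)) = (\<integral>\<^sup>+x. ennreal (exp (u x)) / partition_function u \<partial>pos_lborel)"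
    proof -
      have "emeasure (gibbs u) (space (gibbs u)) = (\<integral>\<^sup>+x. 1 \<partial>gibbs u)" by simp
      also have "\<dots> = (\<integral>\<^sup>+x. ennreal (exp (u x)) / partition_function u * 1 \<partial>pos_lborel)"
        unfolding gibbs_def partition_function_def by (subst nn_integral_density) auto
      finally show ?thesis by simp
    qed
    also have "\<dots> = partition_function u / partition_function u"
      by (subst nn_integral_divide) (auto simp: partition_function_def)
    also have "\<dots> = 1" using partition_function_pos[OF assms] fin
      by (intro ennreal_divide_self) auto
    finally show "emeasure (gibbs u) (space (gibbs u)) = 1" .
  qed
next
  assume P: "prob_space (gibbs u)"
  show "partition_function u < \<infinity>"
  proof (rule ccontr)
    assume "\<not> partition_function u < \<infinity>"
    then have "partition_function u = \<infinity>" by (simp add: less_top[symmetric])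
    then have "gibbs u = density pos_lborel (\<lambda>_. 0)"
      unfolding gibbs_def partition_function_def[symmetric] by (simp add: ennreal_divide_top)
    then have "emeasure (gibbs u) (space (gibbs u)) = 0"
      by (simp add: emeasure_density sets_pos_lborel_I)
    with prob_space.emeasure_space_1[OF P] show False by simp
  qed
qed

lemma nn_integral_gibbs:
  assumes [measurable]: "u \<in> borel_measurable pos_lborel" "h \<in> borel_measurable pos_lborel"
  shows "(\<integral>\<^sup>+x. h x \<partial>gibbs u) = (\<integral>\<^sup>+x. h x * ennreal (exp (u x)) \<partial>pos_lborel) / partition_function u"
proof -
  have "(\<integral>\<^sup>+x. h x \<partial>gibbs u) = (\<integral>\<^sup>+x. (h x * ennreal (exp (u x))) / partition_function u \<partial>pos_lborel)"
    unfolding gibbs_def partition_function_def[symmetric]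
    by (subst nn_integral_density) (auto simp: ennreal_times_divide mult.commute)
  also have "\<dots> = (\<integral>\<^sup>+x. h x * ennreal (exp (u x)) \<partial>pos_lborel) / partition_function u"
    by (subst nn_integral_divide) auto
  finally show ?thesis .
qed

section \<open>Growth of the potentials and tails of the tilted measures\<close>

locale potentials =
  fixes k :: nat and \<phi> :: "nat \<Rightarrow> real \<Rightarrow> real" and \<gamma> :: "nat \<Rightarrow> real"
  assumes k: "k \<ge> 2"
    and pos: "\<And>i x. i \<in> {1..k} \<Longrightarrow> x > 0 \<Longrightarrow> \<phi> i x > 0"
    and C1_smooth: "\<And>i. i \<in> {1..k} \<Longrightarrow> \<phi> i C1_differentiable_on {0<..}"
    and C1_mono: "\<And>i. i \<in> {1..k} \<Longrightarrow> mono_on {0<..} (\<phi> i)"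
    and C1_lim: "\<And>i. i \<in> {1..k} \<Longrightarrow> filterlim (\<phi> i) at_top at_top"
    and C2: "\<And>i c. i \<in> {1..k} \<Longrightarrow> c > 0 \<Longrightarrow>
      (\<integral>\<^sup>+x. ennreal (exp (- c * \<phi> i x)) \<partial>pos_lborel) < \<infinity>"
    and C3: "\<exists>\<kappa>>1. \<forall>i\<in>{1..k - 1}. \<forall>\<^sub>F x in at_top. \<phi> i x powr \<kappa> < \<phi> (i + 1) x"
    and C4: "\<exists>C>0. \<exists>M>0. \<forall>i\<in>{1..k}. \<forall>x>C.
      1 / C * \<phi> i x powr (- M) < deriv (\<phi> i) x \<and> deriv (\<phi> i) x < C * \<phi> i x powr M"
    and \<gamma>_range: "\<And>i. i \<in> {1..k - 1} \<Longrightarrow> 0 < \<gamma> i \<and> \<gamma> i < 1"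
    and \<gamma>_lim: "\<And>i. i \<in> {1..k - 1} \<Longrightarrow>
      ((\<lambda>x. \<phi> i (inv_into {0<..} (\<phi> k) x) / x powr \<gamma> i) \<longlongrightarrow> 1) at_top"
begin

lemma \<phi>_deriv:
  assumes "i \<in> {1..k}" "x > 0"
  shows "(\<phi> i has_real_derivative deriv (\<phi> i) x) (at x)"
proof -
  obtain D where "(\<phi> i has_vector_derivative D x) (at x)"
    using C1_smooth[OF assms(1)] assms(2) unfolding C1_differentiable_on_def by auto
  then have "(\<phi> i has_real_derivative D x) (at x)"
    by (simp add: has_real_derivative_iff_has_vector_derivative)
  then show ?thesis by (simp add: DERIV_imp_deriv)
qed

lemma \<phi>_cont: "i \<in> {1..k} \<Longrightarrow> continuous_on {0<..} (\<phi> i)"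
  using \<phi>_deriv by (intro continuous_at_imp_continuous_on) (auto intro: DERIV_isCont)

lemma \<phi>_meas[measurable]: "i \<in> {1..k} \<Longrightarrow> \<phi> i \<in> borel_measurable pos_lborel"
  by (rule borel_measurable_pos_lborel[OF \<phi>_cont])

lemma \<phi>_mono: "i \<in> {1..k} \<Longrightarrow> 0 < x \<Longrightarrow> x \<le> y \<Longrightarrow> \<phi> i x \<le> \<phi> i y"
  using C1_mono[of i] by (auto simp: mono_on_def)

text \<open>
  The gap \<open>\<phi> i ^ \<kappa> < \<phi> (i + 1)\<close> bounds the quotient by \<open>\<phi> i ^ (1 - \<kappa>)\<close>.
\<close>

lemma \<phi>_ratio_step:
  assumes i: "i \<in> {1..k - 1}"
  shows "((\<lambda>x. \<phi> i x / \<phi> (i + 1) x) \<longlongrightarrow> 0) at_top"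
proof -
  obtain \<kappa> where \<kappa>: "\<kappa> > 1" "\<forall>\<^sub>F x in at_top. \<phi> i x powr \<kappa> < \<phi> (i + 1) x"
    using C3 i by blast
  have "((\<lambda>y::real. y powr (1 - \<kappa>)) \<longlongrightarrow> 0) at_top" using \<kappa>(1) by real_asymp
  then have lim: "((\<lambda>x. \<phi> i x powr (1 - \<kappa>)) \<longlongrightarrow> 0) at_top"
    by (rule filterlim_compose) (rule C1_lim, use i in auto)
  show ?thesis
  proof (rule tendsto_sandwich[OF _ _ tendsto_const lim])
    show "\<forall>\<^sub>F x in at_top. 0 \<le> \<phi> i x / \<phi> (i + 1) x"
      using eventually_gt_at_top[of 0]
      by eventually_elim (use i k pos in \<open>auto intro!: divide_nonneg_nonneg simp: less_imp_le\<close>)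
    show "\<forall>\<^sub>F x in at_top. \<phi> i x / \<phi> (i + 1) x \<le> \<phi> i x powr (1 - \<kappa>)"
      using \<kappa>(2) eventually_gt_at_top[of 0]
    proof eventually_elim
      case (elim x)
      have p: "0 < \<phi> i x" using pos[of i x] i elim by auto
      have "\<phi> i x / \<phi> (i + 1) x \<le> \<phi> i x / \<phi> i x powr \<kappa>"
        using elim p by (intro divide_left_mono mult_pos_pos) (auto intro: less_trans[rotated] simp: less_imp_le)
      then show ?case using p by (simp add: powr_diff)
    qed
  qed
qed

lemma \<phi>_ratio:
  assumes "i \<in> {1..k}" "j \<in> {1..k}" "i < j"
  shows "((\<lambda>x. \<phi> i x / \<phi> j x) \<longlongrightarrow> 0) at_top"
  using assms(3,2)
proof (induction j)
  case (Suc j)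
  show ?case
  proof (cases "i = j")
    case True
    then show ?thesis using \<phi>_ratio_step[of i] assms(1) Suc.prems by auto
  next
    case False
    then have ij: "i < j" "j \<in> {1..k}" "j \<in> {1..k - 1}" using Suc.prems assms(1) by auto
    have "((\<lambda>x. (\<phi> i x / \<phi> j x) * (\<phi> j x / \<phi> (j + 1) x)) \<longlongrightarrow> 0 * 0) at_top"
      by (intro tendsto_mult Suc.IH \<phi>_ratio_step ij)
    moreover have "\<forall>\<^sub>F x in at_top. (\<phi> i x / \<phi> j x) * (\<phi> j x / \<phi> (j + 1) x) = \<phi> i x / \<phi> (Suc j) x"
      using eventually_gt_at_top[of 0]
      by eventually_elim (use pos[OF ij(2)] in \<open>force simp: field_simps\<close>)
    ultimately show ?thesis by (simp only: tendsto_cong mult_zero_left)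
  qed
qed simp

text \<open>
  The potentials are ordered by growth, so the last nonzero coefficient decides the behaviour of a
  linear combination.
\<close>

lemma combination_ratio:
  assumes n: "n \<le> k" and m: "m \<in> {1..n}" and z: "\<And>i. i \<in> {1..n} \<Longrightarrow> m < i \<Longrightarrow> d i = 0"
  shows "((\<lambda>x. (\<Sum>i=1..n. d i * \<phi> i x) / \<phi> m x) \<longlongrightarrow> d m) at_top"
proof -
  have "((\<lambda>x. \<Sum>i=1..n. d i * (\<phi> i x / \<phi> m x)) \<longlongrightarrow> (\<Sum>i=1..n. if i = m then d m else 0)) at_top"
  proof (intro tendsto_sum)
    fix i assume i: "i \<in> {1..n}"
    consider "i < m" | "i = m" | "m < i" by linarith
    then show "((\<lambda>x. d i * (\<phi> i x / \<phi> m x)) \<longlongrightarrow> (if i = m then d m else 0)) at_top"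
    proof cases
      case 1
      then have "((\<lambda>x. d i * (\<phi> i x / \<phi> m x)) \<longlongrightarrow> d i * 0) at_top"
        using i m n by (intro tendsto_mult tendsto_const \<phi>_ratio) auto
      then show ?thesis using 1 by simp
    next
      case 2
      have "\<forall>\<^sub>F x in at_top. d i * (\<phi> i x / \<phi> m x) = d m"
        using eventually_gt_at_top[of 0]
        by eventually_elim (use 2 i n pos[of i] in force)
      then show ?thesis using 2 by (simp add: tendsto_eventually)
    next
      case 3
      then show ?thesis using z[OF i] by simp
    qed
  qed
  moreover have "(\<lambda>x. \<Sum>i=1..n. d i * (\<phi> i x / \<phi> m x)) = (\<lambda>x. (\<Sum>i=1..n. d i * \<phi> i x) / \<phi> m x)"
    by (simp add: sum_divide_distrib)
  ultimately show ?thesis using m by simp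
qed

lemma combination_bounded:
  assumes n: "n \<le> k" and x: "0 < x" "x \<le> X"
  shows "\<bar>\<Sum>i=1..n. d i * \<phi> i x\<bar> \<le> (\<Sum>i=1..n. \<bar>d i\<bar> * \<phi> i X)"
proof -
  have "\<bar>\<Sum>i=1..n. d i * \<phi> i x\<bar> \<le> (\<Sum>i=1..n. \<bar>d i * \<phi> i x\<bar>)" by (rule sum_abs)
  also have "\<dots> \<le> (\<Sum>i=1..n. \<bar>d i\<bar> * \<phi> i X)"
  proof (intro sum_mono)
    fix i assume "i \<in> {1..n}"
    then have i: "i \<in> {1..k}" using n by auto
    then show "\<bar>d i * \<phi> i x\<bar> \<le> \<bar>d i\<bar> * \<phi> i X"
      using pos[OF i x(1)] \<phi>_mono[OF i x] by (simp add: abs_mult mult_left_mono)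
  qed
  finally show ?thesis .
qed

text \<open>
  Bounded functions are integrable near \<open>0\<close> since \<open>(0, X]\<close> has finite length; far out, \<open>exp (- c * \<phi> m)\<close>
  is an integrable majorant.
\<close>

lemma nn_integral_finite_test:
  assumes m: "m \<in> {1..k}" and c: "0 < c" and X: "0 < X"
    and B: "\<And>x. 0 < x \<Longrightarrow> x \<le> X \<Longrightarrow> h x \<le> B"
    and tail: "\<And>x. X < x \<Longrightarrow> h x \<le> exp (- c * \<phi> m x)"
  shows "(\<integral>\<^sup>+x. ennreal (h x) \<partial>pos_lborel) < \<infinity>"
proof -
  have I: "{0<..X} \<in> sets pos_lborel" by (intro sets_pos_lborel_I) auto
  have [measurable]: "\<phi> m \<in> borel_measurable pos_lborel" using m by measurable
  have "(\<integral>\<^sup>+x. ennreal (h x) \<partial>pos_lborel)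
    \<le> (\<integral>\<^sup>+x. ennreal B * indicator {0<..X} x + ennreal (exp (- c * \<phi> m x)) \<partial>pos_lborel)"
  proof (intro nn_integral_mono)
    fix x assume "x \<in> space pos_lborel"
    then have x: "0 < x" by simp
    show "ennreal (h x) \<le> ennreal B * indicator {0<..X} x + ennreal (exp (- c * \<phi> m x))"
    proof (cases "x \<le> X")
      case True
      then show ?thesis using B[OF x True] x by (simp add: ennreal_leI add_increasing2)
    next
      case False
      then show ?thesis using tail[of x] by (simp add: ennreal_leI)
    qed
  qed
  also have "\<dots> = ennreal B * emeasure pos_lborel {0<..X} + (\<integral>\<^sup>+x. ennreal (exp (- c * \<phi> m x)) \<partial>pos_lborel)"
    using I by (subst nn_integral_add) (auto simp: nn_integral_cmult_indicator)
  also have "\<dots> < \<infinity>"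
    using C2[OF m c] X by (auto simp: emeasure_pos_lborel subset_eq ennreal_mult_less_top)
  finally show ?thesis .
qed

lemma \<phi>_k_strict:
  obtains X where "X > 0" "\<And>x y. X < x \<Longrightarrow> x < y \<Longrightarrow> \<phi> k x < \<phi> k y"
proof -
  obtain C M where C: "C > 0" "\<And>x. x > C \<Longrightarrow> 1 / C * \<phi> k x powr (- M) < deriv (\<phi> k) x"
    using C4 k by (metis atLeastAtMost_iff le_refl one_le_numeral order_trans)
  have "\<phi> k x < \<phi> k y" if "C < x" "x < y" for x y
  proof (rule DERIV_pos_imp_increasing[OF that(2)])
    fix t assume t: "x \<le> t" "t \<le> y"
    then have "0 \<le> 1 / C * \<phi> k t powr (- M)" using C(1) by simp
    also have "\<dots> < deriv (\<phi> k) t" using C(2)[of t] t that by simp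
    finally show "\<exists>D. (\<phi> k has_real_derivative D) (at t) \<and> D > 0"
      using \<phi>_deriv[of k t] t that C(1) k by auto
  qed
  then show ?thesis using that C(1) by blast
qed

text \<open>
  \<open>\<phi> k\<close> may be constant on intervals near \<open>0\<close>, so \<open>inv_into\<close> inverts it only far out, where its
  derivative is positive and values cannot be shared with smaller arguments.
\<close>

lemma \<phi>_power_equiv:
  assumes i: "i \<in> {1..k - 1}"
  shows "((\<lambda>x. \<phi> i x / \<phi> k x powr \<gamma> i) \<longlongrightarrow> 1) at_top"
proof -
  obtain X where X: "X > 0" "\<And>x y. X < x \<Longrightarrow> x < y \<Longrightarrow> \<phi> k x < \<phi> k y" using \<phi>_k_strict by blast
  have inv: "inv_into {0<..} (\<phi> k) (\<phi> k x) = x" if x: "x > X + 1" for x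
  proof -
    have ex: "\<phi> k x \<in> \<phi> k ` {0<..}" using x X by auto
    define y where "y = inv_into {0<..} (\<phi> k) (\<phi> k x)"
    have y: "y > 0" "\<phi> k y = \<phi> k x"
      using inv_into_into[OF ex] f_inv_into_f[OF ex] by (auto simp: y_def)
    have "\<phi> k (X + 1) < \<phi> k x" using X x by auto
    then have "y > X + 1" using \<phi>_mono[of k y "X + 1"] y k by force
    then have "y = x" using X(2)[of x y] X(2)[of y x] x y by (metis add_strict_increasing2 less_irrefl linorder_neqE_linordered_idom order_less_trans less_add_one)
    then show ?thesis by (simp add: y_def)
  qed
  have "((\<lambda>x. \<phi> i (inv_into {0<..} (\<phi> k) (\<phi> k x)) / \<phi> k x powr \<gamma> i) \<longlongrightarrow> 1) at_top"
    by (rule filterlim_compose[OF \<gamma>_lim[OF i] C1_lim]) (use k in auto)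
  moreover have "\<forall>\<^sub>F x in at_top. \<phi> i (inv_into {0<..} (\<phi> k) (\<phi> k x)) / \<phi> k x powr \<gamma> i = \<phi> i x / \<phi> k x powr \<gamma> i"
    using eventually_gt_at_top[of "X + 1"] by eventually_elim (simp add: inv)
  ultimately show ?thesis by (simp add: tendsto_cong)
qed

end

lemma square_le_exp_powr:
  fixes d g :: real
  assumes "0 < d" "0 < g"
  shows "\<forall>\<^sub>F y::real in at_top. y\<^sup>2 \<le> exp (d * y powr g)"
  using assms by real_asymp

lemma exp_powr_times_powr_tendsto_0:
  fixes s g M :: real
  assumes "0 < s" "0 < g" "0 < M"
  shows "((\<lambda>y::real. exp (- s * y powr g) * y powr M) \<longlongrightarrow> 0) at_top"
  using assms by real_asymp

context potentials
begin

abbreviation "energy p x \<equiv> \<Sum>i=1..k - 1. p i * \<phi> i x"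

lemma energy_meas[measurable]: "(\<lambda>x. energy p x) \<in> borel_measurable pos_lborel"
proof -
  have [measurable]: "\<phi> i \<in> borel_measurable pos_lborel" if "i \<in> {1..k - 1}" for i
    using that by (intro \<phi>_meas) auto
  show ?thesis by measurable
qed

text \<open>
  The index \<open>m\<close> of the theorem: it decides the tail of \<open>nu k \<phi> p\<close>.
\<close>

definition leading :: "(nat \<Rightarrow> real) \<Rightarrow> nat"
  where "leading p = Max {i \<in> {1..k - 1}. p i \<noteq> 0}"

text \<open>
  If all parameters vanished or the leading one were positive, the energy would be nonnegative far out
  and the density would not be integrable.
\<close>

lemma leading_props:
  assumes "prob_space (nu k \<phi> p)"
  shows "leading p \<in> {1..k - 1}" "p (leading p) < 0" "\<And>i. i \<in> {1..k - 1} \<Longrightarrow> leading p < i \<Longrightarrow> p i = 0"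
proof -
  have fin: "partition_function (energy p) < \<infinity>"
    using assms by (simp only: nu_def prob_space_gibbs_iff[OF energy_meas])
  have big: "\<not> (\<forall>\<^sub>F x in at_top. 0 \<le> energy p x)"
  proof
    assume "\<forall>\<^sub>F x in at_top. 0 \<le> energy p x"
    then obtain X0 where X0: "\<And>x. x \<ge> X0 \<Longrightarrow> 0 \<le> energy p x" by (auto simp: eventually_at_top_linorder)
    define X where "X = max X0 1"
    have X: "X > 0" "\<And>x. x > X \<Longrightarrow> 0 \<le> energy p x" using X0 by (auto simp: X_def)
    have le: "ennreal (real n) \<le> partition_function (energy p)" for n :: nat
    proof -
      have "ennreal (real n) = emeasure pos_lborel {X<..<X + real n}"
        using X by (subst emeasure_pos_lborel) auto
      also have "\<dots> = (\<integral>\<^sup>+x. indicator {X<..<X + real n} x \<partial>pos_lborel)"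
        using X by (subst nn_integral_indicator) (auto intro!: sets_pos_lborel_I)
      also have "\<dots> \<le> partition_function (energy p)"
        unfolding partition_function_def using X(2)
        by (intro nn_integral_mono) (auto split: split_indicator simp: ennreal_1[symmetric] simp del: ennreal_1 intro!: ennreal_leI)
      finally show ?thesis .
    qed
    obtain r where "r \<ge> 0" "partition_function (energy p) = ennreal r"
      using fin by (cases "partition_function (energy p)") auto
    then have "real n \<le> r" for n :: nat using le[of n] by (simp add: ennreal_le_iff)
    then show False using reals_Archimedean2[of r] by (meson not_less)
  qed
  let ?I = "{i \<in> {1..k - 1}. p i \<noteq> 0}"
  have ne: "?I \<noteq> {}"
  proof
    assume "?I = {}"
    then have "energy p x = 0" for x by (intro sum.neutral) auto
    then show False using big by simp
  qed
  have "leading p \<in> ?I" unfolding leading_def using ne by (intro Max_in) auto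
  then have l: "leading p \<in> {1..k - 1}" and lp: "p (leading p) < 0 \<or> p (leading p) > 0" by auto
  show "leading p \<in> {1..k - 1}" by (rule l)
  show z: "p i = 0" if "i \<in> {1..k - 1}" "leading p < i" for i
  proof (rule ccontr)
    assume "p i \<noteq> 0"
    then have "i \<le> leading p" unfolding leading_def using that by (intro Max_ge) auto
    then show False using that by simp
  qed
  show "p (leading p) < 0"
  proof (rule ccontr)
    assume "\<not> p (leading p) < 0"
    then have pp: "p (leading p) > 0" using lp by simp
    have "((\<lambda>x. energy p x / \<phi> (leading p) x) \<longlongrightarrow> p (leading p)) at_top"
      by (rule combination_ratio) (use l z in auto)
    then have "\<forall>\<^sub>F x in at_top. 0 < energy p x / \<phi> (leading p) x"
      using pp by (rule order_tendstoD)
    then have "\<forall>\<^sub>F x in at_top. 0 \<le> energy p x"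
      using eventually_gt_at_top[of 0]
    proof eventually_elim
      case (elim x)
      have "0 < \<phi> (leading p) x" using pos[of "leading p" x] l elim by auto
      then show ?case using elim by (simp add: zero_less_divide_iff)
    qed
    then show False using big by simp
  qed
qed

context
  fixes p :: "nat \<Rightarrow> real"
  assumes P: "prob_space (nu k \<phi> p)"
begin

interpretation \<nu>: prob_space "nu k \<phi> p" by (rule P)

abbreviation "lead \<equiv> leading p"
abbreviation "decay \<equiv> - p (leading p)"
abbreviation "\<nu> \<equiv> nu k \<phi> p"
abbreviation "norm_const \<equiv> enn2real (partition_function (energy p))"

lemma lead_in: "lead \<in> {1..k - 1}" and decay_pos: "decay > 0" using leading_props[OF P] by auto
lemma lead_in_k: "lead \<in> {1..k}" using lead_in by auto
lemma Z_fin: "partition_function (energy p) < \<infinity>"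
  using P by (simp only: nu_def prob_space_gibbs_iff[OF energy_meas])
lemma norm_const: "norm_const > 0" "partition_function (energy p) = ennreal norm_const"
  using Z_fin partition_function_pos[OF energy_meas] by (auto simp: enn2real_positive_iff)
lemma sets_\<nu>[simp]: "sets \<nu> = sets pos_lborel" and space_\<nu>[simp]: "space \<nu> = {0<..}"
  by (auto simp: nu_def)
lemma meas_\<nu>[simp]: "measurable \<nu> K = measurable pos_lborel K"
  by (simp add: nu_def)

lemma energy_power_ratio: "((\<lambda>x. energy p x / \<phi> k x powr \<gamma> lead) \<longlongrightarrow> - decay) at_top"
proof -
  have "((\<lambda>x. (energy p x / \<phi> lead x) * (\<phi> lead x / \<phi> k x powr \<gamma> lead)) \<longlongrightarrow> p lead * 1) at_top"
    by (intro tendsto_mult combination_ratio \<phi>_power_equiv) (use leading_props[OF P] in auto)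
  moreover have "\<forall>\<^sub>F x in at_top. (energy p x / \<phi> lead x) * (\<phi> lead x / \<phi> k x powr \<gamma> lead) = energy p x / \<phi> k x powr \<gamma> lead"
    using eventually_gt_at_top[of 0]
  proof eventually_elim
    case (elim x)
    have "0 < \<phi> lead x" using pos[of lead x] lead_in_k elim by auto
    then show ?case by simp
  qed
  ultimately show ?thesis by (simp only: tendsto_cong mult_1_right minus_minus)
qed

lemma energy_upper:
  assumes "c' < decay"
  shows "\<forall>\<^sub>F x in at_top. energy p x \<le> - c' * \<phi> k x powr \<gamma> lead"
proof -
  have "\<forall>\<^sub>F x in at_top. energy p x / \<phi> k x powr \<gamma> lead < - c'"
    using assms by (intro order_tendstoD[OF energy_power_ratio]) auto
  then show ?thesis using eventually_gt_at_top[of 0]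
  proof eventually_elim
    case (elim x)
    have "0 < \<phi> k x powr \<gamma> lead" using pos[of k x] k elim by auto
    then show ?case using elim by (simp add: divide_less_eq)
  qed
qed

lemma energy_lower:
  assumes "decay < c'"
  shows "\<forall>\<^sub>F x in at_top. - c' * \<phi> k x powr \<gamma> lead \<le> energy p x"
proof -
  have "\<forall>\<^sub>F x in at_top. energy p x / \<phi> k x powr \<gamma> lead > - c'"
    using assms by (intro order_tendstoD[OF energy_power_ratio]) auto
  then show ?thesis using eventually_gt_at_top[of 0]
  proof eventually_elim
    case (elim x)
    have "0 < \<phi> k x powr \<gamma> lead" using pos[of k x] k elim by auto
    then show ?case using elim by (simp add: less_divide_eq)
  qed
qed

lemma power_lower: "\<forall>\<^sub>F x in at_top. \<phi> lead x / 2 \<le> \<phi> k x powr \<gamma> lead"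
proof -
  have "\<forall>\<^sub>F x in at_top. \<phi> lead x / \<phi> k x powr \<gamma> lead < 2"
    by (intro order_tendstoD[OF \<phi>_power_equiv[OF lead_in]]) auto
  then show ?thesis using eventually_gt_at_top[of 0]
  proof eventually_elim
    case (elim x)
    have "0 < \<phi> k x powr \<gamma> lead" using pos[of k x] k elim by auto
    then show ?case using elim by (simp add: divide_less_eq)
  qed
qed

text \<open>
  Against \<open>exp (energy p)\<close>, which decays like \<open>exp (- decay * \<phi> k ^ \<gamma> lead)\<close>, a function of smaller
  exponential rate leaves a factor \<open>exp (- d * \<phi> k ^ \<gamma> lead)\<close>, and \<open>\<phi> k ^ \<gamma> lead\<close> is comparable to
  \<open>\<phi> lead\<close>, whose exponentials are integrable.
\<close>

lemma integrable_\<nu>_test: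
  assumes h[measurable]: "h \<in> borel_measurable pos_lborel"
    and bd: "\<And>X. 0 < X \<Longrightarrow> \<exists>B. \<forall>x. 0 < x \<and> x \<le> X \<longrightarrow> \<bar>h x\<bar> \<le> B"
    and c': "c' < decay" and tail: "\<forall>\<^sub>F x in at_top. \<bar>h x\<bar> \<le> exp (c' * \<phi> k x powr \<gamma> lead)"
  shows "integrable \<nu> h"
proof -
  define d where "d = (decay - c') / 2"
  have d: "d > 0" "c' + d < decay" using c' by (auto simp: d_def field_simps)
  have "\<forall>\<^sub>F x in at_top. \<bar>h x\<bar> * exp (energy p x) \<le> exp (- (d / 2) * \<phi> lead x)"
    using tail energy_upper[OF d(2)] power_lower
  proof eventually_elim
    case (elim x)
    have "\<bar>h x\<bar> * exp (energy p x) \<le> exp (c' * \<phi> k x powr \<gamma> lead) * exp (- (c' + d) * \<phi> k x powr \<gamma> lead)"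
      using elim by (intro mult_mono) auto
    also have "\<dots> = exp (- d * \<phi> k x powr \<gamma> lead)" by (simp add: exp_add[symmetric] algebra_simps)
    also have "\<dots> \<le> exp (- d * (\<phi> lead x / 2))" using elim d by simp
    finally show ?case by simp
  qed
  then obtain X0 where X0: "\<And>x. x \<ge> X0 \<Longrightarrow> \<bar>h x\<bar> * exp (energy p x) \<le> exp (- (d / 2) * \<phi> lead x)"
    by (auto simp: eventually_at_top_linorder)
  define X where "X = max X0 1"
  have X: "X > 0" "X \<ge> X0" by (auto simp: X_def)
  obtain B where B: "\<And>x. 0 < x \<Longrightarrow> x \<le> X \<Longrightarrow> \<bar>h x\<bar> \<le> B" using bd[OF X(1)] by auto
  define E where "E = (\<Sum>i=1..k - 1. \<bar>p i\<bar> * \<phi> i X)"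
  have "(\<integral>\<^sup>+x. ennreal (\<bar>h x\<bar> * exp (energy p x)) \<partial>pos_lborel) < \<infinity>"
  proof (rule nn_integral_finite_test[OF lead_in_k _ X(1)])
    show "0 < d / 2" using d by simp
    show "\<bar>h x\<bar> * exp (energy p x) \<le> B * exp E" if x: "0 < x" "x \<le> X" for x
    proof -
      have "energy p x \<le> E"
        using combination_bounded[of "k - 1" x X p] x by (auto simp: E_def)
      then show ?thesis using B[OF x] by (intro mult_mono) auto
    qed
    show "\<bar>h x\<bar> * exp (energy p x) \<le> exp (- (d / 2) * \<phi> lead x)" if "X < x" for x
      using X0[of x] that X by simp
  qed
  then obtain r where r: "r \<ge> 0" "(\<integral>\<^sup>+x. ennreal (\<bar>h x\<bar> * exp (energy p x)) \<partial>pos_lborel) = ennreal r"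
    by (cases "\<integral>\<^sup>+x. ennreal (\<bar>h x\<bar> * exp (energy p x)) \<partial>pos_lborel") auto
  have "(\<integral>\<^sup>+x. ennreal \<bar>h x\<bar> \<partial>\<nu>) = ennreal r / ennreal norm_const"
    unfolding nu_def using r(2) norm_const(2) by (subst nn_integral_gibbs[OF energy_meas]) (auto simp: ennreal_mult)
  also have "\<dots> < \<infinity>" using r(1) norm_const(1) by (simp add: divide_ennreal)
  finally have "(\<integral>\<^sup>+x. ennreal \<bar>h x\<bar> \<partial>\<nu>) < \<infinity>" .
  then show ?thesis by (intro integrableI_bounded) auto
qed

lemma tail_moment_finite:
  assumes c': "c' < decay"
  shows "integrable \<nu> (\<lambda>x. (\<phi> k x)\<^sup>2 * exp (c' * \<phi> k x powr \<gamma> lead))"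
proof -
  define d where "d = (decay - c') / 2"
  have d: "d > 0" "c' + d < decay" using c' by (auto simp: d_def field_simps)
  have g: "\<gamma> lead > 0" using \<gamma>_range[OF lead_in] by simp
  have [measurable]: "\<phi> k \<in> borel_measurable pos_lborel" using k by (intro \<phi>_meas) auto
  show ?thesis
  proof (rule integrable_\<nu>_test[OF _ _ d(2)])
    show "\<exists>B. \<forall>x. 0 < x \<and> x \<le> X \<longrightarrow> \<bar>(\<phi> k x)\<^sup>2 * exp (c' * \<phi> k x powr \<gamma> lead)\<bar> \<le> B" if X: "0 < X" for X
    proof (intro exI allI impI)
      fix x assume x: "0 < x \<and> x \<le> X"
      have y: "0 < \<phi> k x" "\<phi> k x \<le> \<phi> k X" using x pos[of k x] \<phi>_mono[of k x X] k by auto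
      have "c' * \<phi> k x powr \<gamma> lead \<le> \<bar>c'\<bar> * \<phi> k X powr \<gamma> lead"
        using y g by (intro mult_mono powr_mono2) auto
      then show "\<bar>(\<phi> k x)\<^sup>2 * exp (c' * \<phi> k x powr \<gamma> lead)\<bar> \<le> (\<phi> k X)\<^sup>2 * exp (\<bar>c'\<bar> * \<phi> k X powr \<gamma> lead)"
        using y by (auto simp: abs_mult intro!: mult_mono power_mono)
    qed
    have "\<forall>\<^sub>F y::real in at_top. y\<^sup>2 \<le> exp (d * y powr \<gamma> lead)"
      using d(1) g by (rule square_le_exp_powr)
    then have "\<forall>\<^sub>F x in at_top. (\<phi> k x)\<^sup>2 \<le> exp (d * \<phi> k x powr \<gamma> lead)"
      by (rule eventually_compose_filterlim) (rule C1_lim, use k in auto)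
    then show "\<forall>\<^sub>F x in at_top. \<bar>(\<phi> k x)\<^sup>2 * exp (c' * \<phi> k x powr \<gamma> lead)\<bar> \<le> exp ((c' + d) * \<phi> k x powr \<gamma> lead)"
      by eventually_elim (simp add: abs_mult distrib_right exp_add)
  qed measurable
qed

lemma \<phi>_small:
  assumes i: "i \<in> {1..k - 1}" and e: "\<eta> > 0"
  shows "\<exists>A. \<forall>x\<in>{0<..}. \<phi> i x \<le> A + \<eta> * \<phi> k x"
proof -
  have "((\<lambda>x. \<phi> i x / \<phi> k x) \<longlongrightarrow> 0) at_top" using i by (intro \<phi>_ratio) auto
  then have "\<forall>\<^sub>F x in at_top. \<phi> i x / \<phi> k x < \<eta>" using e by (rule order_tendstoD)
  then obtain X0 where X0: "\<And>x. x \<ge> X0 \<Longrightarrow> \<phi> i x / \<phi> k x < \<eta>" by (auto simp: eventually_at_top_linorder)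
  define X where "X = max X0 1"
  have "\<phi> i x \<le> \<phi> i X + \<eta> * \<phi> k x" if x: "0 < x" for x
  proof (cases "x \<le> X")
    case True
    then have "\<phi> i x \<le> \<phi> i X" using \<phi>_mono[of i x X] i x by auto
    then show ?thesis using pos[of k x] k x e by (auto intro: add_increasing2)
  next
    case False
    then have "\<phi> i x < \<eta> * \<phi> k x" using X0[of x] pos[of k x] k x by (simp add: X_def divide_less_eq)
    moreover have "0 < \<phi> i X" using pos[of i X] i by (auto simp: X_def)
    ultimately show ?thesis by simp
  qed
  then show ?thesis by auto
qed

lemma \<phi>_k_square: "integrable \<nu> (\<lambda>x. (\<phi> k x)\<^sup>2)"
proof (rule Bochner_Integration.integrable_bound[OF tail_moment_finite[of "decay / 2"]])
  have [measurable]: "\<phi> k \<in> borel_measurable pos_lborel" using k by (intro \<phi>_meas) auto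
  show "decay / 2 < decay" using decay_pos by simp
  show "(\<lambda>x. (\<phi> k x)\<^sup>2) \<in> borel_measurable \<nu>" by simp
  show "AE x in \<nu>. norm ((\<phi> k x)\<^sup>2) \<le> norm ((\<phi> k x)\<^sup>2 * exp (decay / 2 * \<phi> k x powr \<gamma> lead))"
    using decay_pos by (intro AE_I2) (auto simp: abs_mult mult_le_cancel_left1 mult_le_0_iff)
qed

lemma \<phi>_square:
  assumes i: "i \<in> {1..k}"
  shows "integrable \<nu> (\<lambda>x. (\<phi> i x)\<^sup>2)"
proof (cases "i = k")
  case True
  then show ?thesis using \<phi>_k_square by simp
next
  case False
  then have i': "i \<in> {1..k - 1}" using i by auto
  obtain A where A: "\<And>x. 0 < x \<Longrightarrow> \<phi> i x \<le> A + 1 * \<phi> k x" using \<phi>_small[OF i', of 1] by auto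
  have [measurable]: "\<phi> i \<in> borel_measurable pos_lborel" using i by measurable
  show ?thesis
  proof (rule Bochner_Integration.integrable_bound)
    show "integrable \<nu> (\<lambda>x. 2 * A\<^sup>2 + 2 * (\<phi> k x)\<^sup>2)" using \<phi>_k_square by auto
    show "AE x in \<nu>. norm ((\<phi> i x)\<^sup>2) \<le> norm (2 * A\<^sup>2 + 2 * (\<phi> k x)\<^sup>2)"
    proof (intro AE_I2)
      fix x assume "x \<in> space \<nu>"
      then have x: "0 < x" by simp
      have "(\<phi> i x)\<^sup>2 \<le> (A + \<phi> k x)\<^sup>2" using A[OF x] pos[OF i x] by (intro power_mono) auto
      also have "\<dots> \<le> 2 * A\<^sup>2 + 2 * (\<phi> k x)\<^sup>2"
        using zero_le_power2[of "A - \<phi> k x"] by (simp add: power2_eq_square algebra_simps)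
      finally show "norm ((\<phi> i x)\<^sup>2) \<le> norm (2 * A\<^sup>2 + 2 * (\<phi> k x)\<^sup>2)" by simp
    qed
  qed simp
qed

text \<open>
  The set has length at least of the order of a power of \<open>n\<close>, by the mean value theorem and the
  polynomial bound on the derivative of \<open>\<phi> k\<close>, and the density is at least
  \<open>exp (- c1 * (n * \<beta>)^\<gamma>) / norm_const\<close> on it for any \<open>c1 > decay\<close>. Choosing \<open>c1 < c'\<close> absorbs the power of \<open>n\<close>.
\<close>

lemma tail_mass_lower:
  assumes c': "decay < c'" and \<alpha>: "0 < \<alpha>" "\<alpha> < \<beta>"
  shows "\<forall>\<^sub>F n in sequentially. exp (- c' * (real n * \<beta>) powr \<gamma> lead)
    \<le> measure \<nu> {x \<in> space \<nu>. real n * \<alpha> \<le> \<phi> k x \<and> \<phi> k x \<le> real n * \<beta>}"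
proof -
  have kk: "k \<in> {1..k}" using k by auto
  have [measurable]: "\<phi> k \<in> borel_measurable pos_lborel" using kk by measurable
  have g: "0 < \<gamma> lead" using \<gamma>_range[OF lead_in] by simp
  obtain C M where C: "C > 0" "M > 0" "\<And>x. x > C \<Longrightarrow> deriv (\<phi> k) x < C * \<phi> k x powr M"
    using C4 kk by fast
  define c1 where "c1 = (decay + c') / 2"
  have c1: "decay < c1" "c1 < c'" using c' by (auto simp: c1_def)
  have c1p: "0 < c1" using decay_pos c1 by linarith
  obtain X0 where X0: "\<And>x. x \<ge> X0 \<Longrightarrow> - c1 * \<phi> k x powr \<gamma> lead \<le> energy p x"
    using energy_lower[OF c1(1)] by (auto simp: eventually_at_top_linorder)
  define X where "X = max X0 C + 1"
  have X: "X > 0" "X > C" "X \<ge> X0" using C by (auto simp: X_def)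
  have e1: "\<forall>\<^sub>F n::nat in sequentially. \<phi> k X < real n * \<alpha>" using \<alpha> by real_asymp
  have e2: "\<forall>\<^sub>F n::nat in sequentially. exp (- c' * (real n * \<beta>) powr \<gamma> lead)
    \<le> real n * (\<beta> - \<alpha>) / (C * (real n * \<beta>) powr M) * (exp (- c1 * (real n * \<beta>) powr \<gamma> lead) / norm_const)"
  proof -
    define s where "s = c' - c1"
    have s: "0 < s" using c1 by (simp add: s_def)
    have "((\<lambda>y::real. exp (- s * y powr \<gamma> lead) * y powr M) \<longlongrightarrow> 0) at_top"
      using s g C(2) by (rule exp_powr_times_powr_tendsto_0)
    moreover have "filterlim (\<lambda>n::nat. real n * \<beta>) at_top sequentially" using \<alpha> by real_asymp
    ultimately have "(\<lambda>n. exp (- s * (real n * \<beta>) powr \<gamma> lead) * (real n * \<beta>) powr M) \<longlonglongrightarrow> 0"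
      by (rule filterlim_compose)
    then have "\<forall>\<^sub>F n in sequentially.
      exp (- s * (real n * \<beta>) powr \<gamma> lead) * (real n * \<beta>) powr M < (\<beta> - \<alpha>) / (C * norm_const)"
      by (rule order_tendstoD) (use \<alpha> C norm_const in auto)
    then show ?thesis using eventually_gt_at_top[of 0]
    proof eventually_elim
      case (elim n)
      define r where "r = (\<beta> - \<alpha>) / (C * norm_const)"
      define P where "P = (real n * \<beta>) powr M"
      have P: "0 < P" using elim \<alpha> by (simp add: P_def)
      have "0 \<le> r" using \<alpha> C norm_const by (simp add: r_def)
      moreover have "1 \<le> real n" using elim(2) by simp
      ultimately have "1 * r \<le> real n * r" by (rule mult_right_mono[rotated])
      then have "exp (- s * (real n * \<beta>) powr \<gamma> lead) * P \<le> real n * r"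
        using elim(1) unfolding r_def[symmetric] P_def[symmetric] by linarith
      then have "exp (- s * (real n * \<beta>) powr \<gamma> lead) \<le> real n * r / P"
        using P by (simp add: pos_le_divide_eq)
      also have "real n * r / P = real n * (\<beta> - \<alpha>) / (C * P) / norm_const"
        by (simp add: r_def)
      finally have q: "exp (- s * (real n * \<beta>) powr \<gamma> lead) \<le> real n * (\<beta> - \<alpha>) / (C * (real n * \<beta>) powr M) / norm_const"
        by (simp only: P_def)
      have "exp (- c' * (real n * \<beta>) powr \<gamma> lead)
        = exp (- (c' - c1) * (real n * \<beta>) powr \<gamma> lead) * exp (- c1 * (real n * \<beta>) powr \<gamma> lead)"
        by (simp add: exp_add[symmetric] algebra_simps)
      also have "\<dots> \<le> (real n * (\<beta> - \<alpha>) / (C * (real n * \<beta>) powr M) / norm_const) * exp (- c1 * (real n * \<beta>) powr \<gamma> lead)"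
        using q unfolding s_def by (intro mult_right_mono) auto
      finally show ?case by simp
    qed
  qed
  show ?thesis using e1 e2 eventually_gt_at_top[of 0]
  proof eventually_elim
    case (elim n)
    let ?J = "{x \<in> space \<nu>. real n * \<alpha> \<le> \<phi> k x \<and> \<phi> k x \<le> real n * \<beta>}"
    define z where "z = (real n * \<beta>) powr \<gamma> lead"
    have n: "real n > 0" using elim by simp
    have ab: "real n * \<alpha> < real n * \<beta>" using n \<alpha> by simp
    have cont: "continuous_on {s..t} (\<phi> k)" if "0 < s" for s t
      by (rule continuous_on_subset[OF \<phi>_cont[OF kk]]) (use that in auto)
    have "\<forall>\<^sub>F x in at_top. X < x \<and> real n * \<beta> < \<phi> k x"
      using C1_lim[OF kk] by (intro eventually_conj eventually_gt_at_top) (simp add: filterlim_at_top_dense)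
    then obtain T where T: "T > X" "real n * \<beta> < \<phi> k T"
      by (auto simp: eventually_at_top_linorder)
    obtain x1 where x1: "X \<le> x1" "x1 \<le> T" "\<phi> k x1 = real n * \<alpha>"
      using IVT'[of "\<phi> k" X "real n * \<alpha>" T] cont[OF X(1)] T elim(1) ab by auto
    obtain x2 where x2: "x1 \<le> x2" "x2 \<le> T" "\<phi> k x2 = real n * \<beta>"
      using IVT'[of "\<phi> k" x1 "real n * \<beta>" T] cont[of x1] T x1 ab X by auto
    have x12: "x1 < x2" using x1 x2 ab by (metis less_irrefl order_le_less)
    have range: "real n * \<alpha> \<le> \<phi> k x \<and> \<phi> k x \<le> real n * \<beta>" if "x1 \<le> x" "x \<le> x2" for x
      using \<phi>_mono[OF kk, of x1 x] \<phi>_mono[OF kk, of x x2] that x1 x2 X by auto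
    have len: "real n * (\<beta> - \<alpha>) / (C * (real n * \<beta>) powr M) \<le> x2 - x1"
    proof -
      obtain \<xi> where \<xi>: "x1 < \<xi>" "\<xi> < x2" "\<phi> k x2 - \<phi> k x1 = (x2 - x1) * deriv (\<phi> k) \<xi>"
        using MVT2[OF x12, of "\<phi> k" "deriv (\<phi> k)"] \<phi>_deriv[OF kk] x1 X by force
      have p0: "0 < \<phi> k \<xi>" using pos[OF kk] \<xi> x1 X by auto
      have "deriv (\<phi> k) \<xi> \<le> C * \<phi> k \<xi> powr M" using C(3)[of \<xi>] \<xi> x1 X by simp
      also have "\<dots> \<le> C * (real n * \<beta>) powr M"
        using range[of \<xi>] \<xi> C p0 by (intro mult_left_mono powr_mono2) auto
      finally have "(x2 - x1) * deriv (\<phi> k) \<xi> \<le> (x2 - x1) * (C * (real n * \<beta>) powr M)"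
        using x12 by (intro mult_left_mono) auto
      then have "real n * (\<beta> - \<alpha>) \<le> (x2 - x1) * (C * (real n * \<beta>) powr M)"
        using \<xi>(3) x1(3) x2(3) by (simp add: right_diff_distrib)
      then show ?thesis using C n \<alpha> by (simp add: divide_le_eq)
    qed
    have I: "{x1..x2} \<in> sets pos_lborel" using x1 X by (intro sets_pos_lborel_I) auto
    have [measurable]: "\<phi> k \<in> borel_measurable \<nu>" by simp
    have Jm: "?J \<in> sets \<nu>" by measurable
    have "ennreal ((x2 - x1) * (exp (- c1 * z) / norm_const)) = (\<integral>\<^sup>+x. ennreal (exp (- c1 * z) / norm_const) * indicator {x1..x2} x \<partial>pos_lborel)"
    proof -
      have "emeasure pos_lborel {x1..x2} = ennreal (x2 - x1)"
        using x12 x1 X by (subst emeasure_pos_lborel) auto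
      then show ?thesis unfolding nn_integral_cmult_indicator[OF I] using x12 norm_const(1)
        by (simp add: ennreal_mult[symmetric] mult.commute)
    qed
    also have "\<dots> \<le> (\<integral>\<^sup>+x. ennreal (exp (energy p x) / norm_const) * indicator ?J x \<partial>pos_lborel)"
    proof (intro nn_integral_mono)
      fix x
      show "ennreal (exp (- c1 * z) / norm_const) * indicator {x1..x2} x \<le> ennreal (exp (energy p x) / norm_const) * indicator ?J x"
      proof (cases "x \<in> {x1..x2}")
        case True
        have "\<phi> k x powr \<gamma> lead \<le> z" unfolding z_def
          using range[of x] True g pos[OF kk, of x] x1 X by (intro powr_mono2) auto
        then have "- c1 * z \<le> - c1 * \<phi> k x powr \<gamma> lead" using c1p by simp
        also have "\<dots> \<le> energy p x" using X0[of x] True x1 X by simp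
        finally have "exp (- c1 * z) / norm_const \<le> exp (energy p x) / norm_const" using norm_const by (intro divide_right_mono) auto
        moreover have "x \<in> ?J" using True range[of x] x1 X by auto
        ultimately show ?thesis using True by (simp add: ennreal_leI)
      qed simp
    qed
    also have "\<dots> = emeasure \<nu> ?J"
    proof -
      have [measurable]: "(\<lambda>x. ennreal (exp (energy p x) / norm_const)) \<in> borel_measurable pos_lborel"
        by measurable
      show ?thesis using Jm unfolding nu_def gibbs_eq_density[OF energy_meas Z_fin]
        by (intro emeasure_density[symmetric]) (simp_all del: One_nat_def)
    qed
    finally have "(x2 - x1) * (exp (- c1 * z) / norm_const) \<le> measure \<nu> ?J"
      by (simp add: \<nu>.emeasure_eq_measure)
    moreover have "real n * (\<beta> - \<alpha>) / (C * (real n * \<beta>) powr M) * (exp (- c1 * z) / norm_const) \<le> (x2 - x1) * (exp (- c1 * z) / norm_const)"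
      using norm_const by (intro mult_right_mono len) auto
    ultimately show ?case using elim(2) unfolding z_def by linarith
  qed
qed

end

end

section \<open>The subdifferential on the boundary of the domain\<close>

lemma exp_eq_one_plus_iff:
  fixes z :: real
  shows "exp z = 1 + z \<longleftrightarrow> z = 0"
proof
  assume e: "exp z = 1 + z"
  show "z = 0"
  proof (cases "1 + z / 2 \<ge> 0")
    case True
    have "(1 + z / 2)\<^sup>2 \<le> (exp (z / 2))\<^sup>2" using True by (intro power_mono) auto
    also have "(exp (z / 2))\<^sup>2 = exp z" by (simp add: power2_eq_square flip: exp_add)
    finally have "z\<^sup>2 \<le> 0" using e by (simp add: power2_eq_square algebra_simps)
    then show ?thesis by simp
  next
    case False
    then have "1 + z < 0" by simp
    then show ?thesis using e exp_gt_zero[of z] by simp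
  qed
qed simp

lemma elog_cmult:
  assumes "r > 0"
  shows "elog (ennreal r * t) = ereal (ln r) + elog t"
proof (cases t)
  case (real s)
  then show ?thesis using assms
    by (cases "s = 0") (auto simp: elog_def ennreal_mult[symmetric] ln_mult)
next
  case top
  then show ?thesis using assms by (simp add: elog_def ennreal_mult_top)
qed

lemma ereal_le_elog_iff: "ereal s \<le> elog t \<longleftrightarrow> ennreal (exp s) \<le> t"
proof (cases t)
  case (real r)
  then show ?thesis by (cases "r = 0") (auto simp: elog_def ln_ge_iff)
next
  case top
  then show ?thesis by (simp add: elog_def)
qed

context potentials
begin

lemma big_jump_nu:
  assumes P: "prob_space (nu k \<phi> p)"
  shows "big_jump (nu k \<phi> p) k \<phi> (\<gamma> (leading p)) (- p (leading p))"
proof -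
  interpret \<nu>: prob_space "nu k \<phi> p" by (rule P)
  show ?thesis
  proof
    show "1 \<le> k" using k by simp
    show "\<phi> i \<in> borel_measurable (nu k \<phi> p)" if "i \<in> {1..k}" for i
      using \<phi>_meas[OF that] by (simp add: meas_\<nu>[OF P])
    show "0 < \<phi> i x" if "i \<in> {1..k}" "x \<in> space (nu k \<phi> p)" for i x
      using pos[OF that(1)] that(2) by (simp add: space_\<nu>[OF P])
    show "\<exists>A. \<forall>x\<in>space (nu k \<phi> p). \<phi> i x \<le> A + \<eta> * \<phi> k x" if "i \<in> {1..k - 1}" "0 < \<eta>" for i \<eta>
      using \<phi>_small[OF P that] by (simp add: space_\<nu>[OF P])
  qed (use leading_props[OF P] \<gamma>_range \<phi>_square[OF P] tail_moment_finite[OF P] tail_mass_lower[OF P] in auto)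
qed

abbreviation "dual d x \<equiv> \<Sum>i=1..k. d i * \<phi> i x"

lemma dual_meas[measurable]: "(\<lambda>x. dual d x) \<in> borel_measurable pos_lborel"
  by measurable

lemma dual_split: "dual d x = energy d x + d k * \<phi> k x"
  using k by (cases k) auto

text \<open>
  \<open>logmgf\<close> refers to the measure with density proportional to \<open>exp (- \<phi> 1)\<close>, while \<open>nu\<close> refers to
  Lebesgue measure. Subtracting \<open>1\<close> from the first parameter translates between the two.
\<close>

definition shift :: "(nat \<Rightarrow> real) \<Rightarrow> nat \<Rightarrow> real"
  where "shift p = (\<lambda>i\<in>{1..k - 1}. p i - (if i = 1 then 1 else 0))"

lemma energy_shift:
  assumes "p k = 0"
  shows "energy (shift p) x = dual p x - \<phi> 1 x"
proof -
  have "energy (shift p) x = (\<Sum>i=1..k - 1. p i * \<phi> i x - (if i = 1 then \<phi> 1 x else 0))"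
    by (intro sum.cong) (auto simp: shift_def algebra_simps)
  also have "\<dots> = energy p x - \<phi> 1 x"
    using k by (simp add: sum_subtractf)
  finally show ?thesis unfolding dual_split assms by simp
qed

definition mean :: "(nat \<Rightarrow> real) \<Rightarrow> nat \<Rightarrow> real"
  where "mean p i = (LINT x|nu k \<phi> p. \<phi> i x)"

lemma \<phi>_integrable:
  assumes "prob_space (nu k \<phi> p)" "i \<in> {1..k}"
  shows "integrable (nu k \<phi> p) (\<phi> i)"
  using big_jump.f_int[OF big_jump_nu] assms by auto

lemma nn_integral_\<phi>:
  assumes "prob_space (nu k \<phi> p)" "i \<in> {1..k}"
  shows "(\<integral>\<^sup>+x. ennreal (\<phi> i x) \<partial>nu k \<phi> p) = ennreal (mean p i)" "0 \<le> mean p i"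
proof -
  have ae: "AE x in nu k \<phi> p. 0 \<le> \<phi> i x"
    using pos[OF assms(2)] by (intro AE_I2) (auto simp: space_\<nu>[OF assms(1)] less_imp_le)
  show "(\<integral>\<^sup>+x. ennreal (\<phi> i x) \<partial>nu k \<phi> p) = ennreal (mean p i)"
    unfolding mean_def by (rule nn_integral_eq_integral[OF \<phi>_integrable[OF assms] ae])
  show "0 \<le> mean p i" unfolding mean_def by (rule integral_nonneg_AE[OF ae])
qed

lemma dual_integrable:
  assumes P: "prob_space (nu k \<phi> p)"
  shows "integrable (nu k \<phi> p) (\<lambda>x. dual d x)"
    and "(LINT x|nu k \<phi> p. dual d x) = (\<Sum>i=1..k. d i * mean p i)"
    and "integrable (nu k \<phi> p) (\<lambda>x. (dual d x)\<^sup>2)"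
proof -
  show "integrable (nu k \<phi> p) (\<lambda>x. dual d x)"
    using \<phi>_integrable[OF P] by auto
  show "(LINT x|nu k \<phi> p. dual d x) = (\<Sum>i=1..k. d i * mean p i)"
    using \<phi>_integrable[OF P] by (subst Bochner_Integration.integral_sum) (auto simp: mean_def)
  show "integrable (nu k \<phi> p) (\<lambda>x. (dual d x)\<^sup>2)"
  proof (rule Bochner_Integration.integrable_bound)
    show "integrable (nu k \<phi> p) (\<lambda>x. real (card {1..k}) * (\<Sum>i=1..k. (d i)\<^sup>2 * (\<phi> i x)\<^sup>2))"
      using \<phi>_square[OF P] by auto
    show "AE x in nu k \<phi> p. norm ((dual d x)\<^sup>2) \<le> norm (real (card {1..k}) * (\<Sum>i=1..k. (d i)\<^sup>2 * (\<phi> i x)\<^sup>2))"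
    proof (intro AE_I2)
      fix x
      have "(dual d x)\<^sup>2 \<le> real (card {1..k}) * (\<Sum>i=1..k. (d i * \<phi> i x)\<^sup>2)"
        using sum_squared_le_sum_of_squares[of "\<lambda>i. d i * \<phi> i x" "{1..k}"] by (simp add: mult.commute)
      moreover have "0 \<le> (\<Sum>i=1..k. (d i)\<^sup>2 * (\<phi> i x)\<^sup>2)" by (intro sum_nonneg) auto
      ultimately show "norm ((dual d x)\<^sup>2) \<le> norm (real (card {1..k}) * (\<Sum>i=1..k. (d i)\<^sup>2 * (\<phi> i x)\<^sup>2))"
        by (simp add: power_mult_distrib)
    qed
  qed (use dual_meas in \<open>simp add: meas_\<nu>[OF P]\<close>)
qed

text \<open>
  The tangent of the exponential at the mean is integrated; an infinite right-hand side is trivial.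
\<close>

lemma jensen_exp:
  assumes P: "prob_space (nu k \<phi> p)"
  shows "ennreal (exp (\<Sum>i=1..k. d i * mean p i)) \<le> (\<integral>\<^sup>+x. ennreal (exp (dual d x)) \<partial>nu k \<phi> p)"
proof (cases "(\<integral>\<^sup>+x. ennreal (exp (dual d x)) \<partial>nu k \<phi> p) = \<infinity>")
  case False
  interpret \<nu>: prob_space "nu k \<phi> p" by (rule P)
  define F where "F = (\<Sum>i=1..k. d i * mean p i)"
  have int: "integrable (nu k \<phi> p) (\<lambda>x. exp (dual d x))"
    using False by (intro integrableI_bounded) (auto simp: meas_\<nu>[OF P] less_top[symmetric])
  have "exp F = (LINT x|nu k \<phi> p. exp F * (1 + (dual d x - F)))"
    using dual_integrable[OF P, of d] by (simp add: \<nu>.prob_space F_def)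
  also have "\<dots> \<le> (LINT x|nu k \<phi> p. exp (dual d x))"
  proof (intro integral_mono int)
    show "integrable (nu k \<phi> p) (\<lambda>x. exp F * (1 + (dual d x - F)))"
      using dual_integrable(1)[OF P, of d] by auto
    show "exp F * (1 + (dual d x - F)) \<le> exp (dual d x)" for x
    proof -
      have "exp F * (1 + (dual d x - F)) \<le> exp F * exp (dual d x - F)"
        by (intro mult_left_mono exp_ge_add_one_self) auto
      then show ?thesis by (simp flip: exp_add)
    qed
  qed
  finally show ?thesis using int by (subst nn_integral_eq_integral) (auto simp: F_def)
qed simp

text \<open>
  \<open>- \<phi> k\<close> outweighs the other terms, each of which is at most \<open>A i + \<eta> * \<phi> k\<close> up to its coefficient;
  \<open>\<eta>\<close> is chosen such that the total weight of \<open>\<phi> k\<close> in these bounds is at most \<open>1\<close>.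
\<close>

lemma dual_bounded_above:
  assumes P: "prob_space (nu k \<phi> p)" and d: "d k = -1"
  shows "\<exists>B\<ge>0. \<forall>x>0. dual d x \<le> B"
proof -
  define D where "D = (\<Sum>i=1..k - 1. \<bar>d i\<bar>)"
  have D: "D \<ge> 0" unfolding D_def by (intro sum_nonneg) auto
  define \<eta> where "\<eta> = 1 / (D + 1)"
  have \<eta>: "\<eta> > 0" "D * \<eta> \<le> 1" using D by (auto simp: \<eta>_def divide_simps)
  obtain A where A: "\<And>i x. i \<in> {1..k - 1} \<Longrightarrow> 0 < x \<Longrightarrow> \<phi> i x \<le> A i + \<eta> * \<phi> k x"
    using \<phi>_small[OF P _ \<eta>(1)] by (metis greaterThan_iff)
  have bd: "dual d x \<le> (\<Sum>i=1..k - 1. \<bar>d i\<bar> * A i)" if x: "0 < x" for x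
  proof -
    have "energy d x \<le> (\<Sum>i=1..k - 1. \<bar>d i\<bar> * (A i + \<eta> * \<phi> k x))"
    proof (intro sum_mono)
      fix i assume i: "i \<in> {1..k - 1}"
      then have "0 < \<phi> i x" using pos[of i x] x by auto
      then have "d i * \<phi> i x \<le> \<bar>d i\<bar> * \<phi> i x" by (intro mult_right_mono) auto
      also have "\<dots> \<le> \<bar>d i\<bar> * (A i + \<eta> * \<phi> k x)" using A[OF i x] by (intro mult_left_mono) auto
      finally show "d i * \<phi> i x \<le> \<bar>d i\<bar> * (A i + \<eta> * \<phi> k x)" .
    qed
    also have "\<dots> = (\<Sum>i=1..k - 1. \<bar>d i\<bar> * A i) + D * \<eta> * \<phi> k x"
      by (simp add: D_def algebra_simps sum.distrib sum_distrib_left sum_distrib_right)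
    also have "D * \<eta> * \<phi> k x \<le> 1 * \<phi> k x"
      using \<eta> pos[of k x] x k by (intro mult_right_mono) auto
    finally show ?thesis unfolding dual_split d by simp
  qed
  show ?thesis
    using bd by (intro exI[of _ "max 0 (\<Sum>i=1..k - 1. \<bar>d i\<bar> * A i)"]) (auto simp: le_max_iff_disj)
qed

text \<open>
  The right derivative of \<open>t \<mapsto> \<integral> exp (t * f) d\<nu>\<close> at \<open>0\<close> is at most \<open>\<integral> f d\<nu>\<close>: the second-order remainder is
  at most \<open>t\<^sup>2 * K\<close> as \<open>f\<close> is bounded above and square integrable.
\<close>

lemma supporting_slope_le_mean:
  assumes P: "prob_space (nu k \<phi> p)" and d: "d k = -1"
    and v: "\<And>t. 0 < t \<Longrightarrow> t \<le> 1 \<Longrightarrow>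
      ennreal (exp (t * s)) \<le> (\<integral>\<^sup>+x. ennreal (exp (t * dual d x)) \<partial>nu k \<phi> p)"
  shows "s \<le> (\<Sum>i=1..k. d i * mean p i)"
proof -
  interpret \<nu>: prob_space "nu k \<phi> p" by (rule P)
  obtain B where B: "B \<ge> 0" "\<And>x. x > 0 \<Longrightarrow> dual d x \<le> B" using dual_bounded_above[where p=p and d=d, OF P d] by blast
  define F where "F = (\<Sum>i=1..k. d i * mean p i)"
  define K where "K = (LINT x|nu k \<phi> p. (dual d x)\<^sup>2) * exp B"
  have le: "s \<le> F + t * K" if t: "0 < t" "t \<le> 1" for t
  proof -
    let ?g = "\<lambda>x. 1 + t * dual d x + t\<^sup>2 * ((dual d x)\<^sup>2 * exp B)"
    have g: "exp (t * dual d x) \<le> ?g x" if x: "x > 0" for x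
    proof -
      have "t * dual d x \<le> B"
      proof (cases "dual d x \<ge> 0")
        case True
        then have "t * dual d x \<le> dual d x" using t by (simp add: mult_left_le_one_le)
        then show ?thesis using B(2)[OF x] by simp
      next
        case False
        then have "t * dual d x \<le> 0" using t by (simp add: mult_le_0_iff)
        then show ?thesis using B by simp
      qed
      from exp_le_quadratic[OF this B(1)] show ?thesis
        by (simp add: power_mult_distrib mult_ac)
    qed
    have gi: "integrable (nu k \<phi> p) ?g"
      using dual_integrable[OF P, of d] by auto
    have "ennreal (exp (t * s)) \<le> (\<integral>\<^sup>+x. ennreal (exp (t * dual d x)) \<partial>nu k \<phi> p)" by (rule v[OF t])
    also have "\<dots> \<le> (\<integral>\<^sup>+x. ennreal (?g x) \<partial>nu k \<phi> p)"
      using g by (intro nn_integral_mono ennreal_leI) (simp add: space_\<nu>[OF P])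
    also have "\<dots> = ennreal (LINT x|nu k \<phi> p. ?g x)"
      using g by (intro nn_integral_eq_integral gi AE_I2)
        (auto simp: space_\<nu>[OF P] intro: order_trans[OF exp_ge_zero])
    also have "(LINT x|nu k \<phi> p. ?g x) = 1 + t * F + t\<^sup>2 * K"
      using dual_integrable[OF P, of d] by (simp add: \<nu>.prob_space F_def K_def)
    finally have "exp (t * s) \<le> 1 + t * F + t\<^sup>2 * K"
      by (smt (verit) ennreal_le_iff2 exp_gt_zero)
    moreover have "1 + t * s \<le> exp (t * s)" by (rule exp_ge_add_one_self)
    ultimately have "t * s \<le> t * F + t\<^sup>2 * K" by linarith
    then have "t * s \<le> t * (F + t * K)" by (simp add: algebra_simps power2_eq_square)
    then show ?thesis using t by simp
  qed
  have "((\<lambda>t. F + t * K) \<longlongrightarrow> F + 0 * K) (at_right 0)"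
    by (intro tendsto_intros)
  moreover have "\<forall>\<^sub>F t in at_right 0. s \<le> F + t * K"
    using le by (intro eventually_at_rightI[of 0 1]) auto
  ultimately have "s \<le> F + 0 * K"
    by (intro tendsto_lowerbound) auto
  then show ?thesis by (simp add: F_def)
qed

text \<open>
  The parameters \<open>(p 1, \<dots>, p (k - 1), 0)\<close> lie on the boundary of the set where \<open>logmgf\<close> is finite, and
  moving a single \<open>p i\<close> may leave that set. However, every direction that decreases the last parameter
  stays inside, whatever its other components are. So
  \<open>(\<Sum>i<k. d i * (mean p i - v i)) \<ge> mean p k - v k\<close> for all values \<open>d 1, \<dots>, d (k - 1)\<close>, and a linear form
  bounded below vanishes.
\<close>

lemma supporting_vector:
  assumes P: "prob_space (nu k \<phi> p)"
    and v: "\<And>d. d \<in> vecs k \<Longrightarrow>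
      ennreal (exp (\<Sum>i=1..k. v i * d i)) \<le> (\<integral>\<^sup>+x. ennreal (exp (dual d x)) \<partial>nu k \<phi> p)"
  shows "\<And>i. i \<in> {1..k - 1} \<Longrightarrow> v i = mean p i" and "mean p k \<le> v k"
proof -
  have le: "(\<Sum>i=1..k. v i * d i) \<le> (\<Sum>i=1..k. d i * mean p i)" if d: "d k = -1" for d
  proof (rule supporting_slope_le_mean[where p=p and d=d, OF P d])
    fix t :: real
    let ?td = "\<lambda>i\<in>{1..k}. t * d i"
    have "(\<Sum>i=1..k. v i * ?td i) = t * (\<Sum>i=1..k. v i * d i)"
      unfolding sum_distrib_left by (intro sum.cong) auto
    moreover have "dual ?td x = t * dual d x" for x
      unfolding sum_distrib_left by (intro sum.cong) auto
    ultimately show "ennreal (exp (t * (\<Sum>i=1..k. v i * d i))) \<le> (\<integral>\<^sup>+x. ennreal (exp (t * dual d x)) \<partial>nu k \<phi> p)"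
      using v[of ?td] by simp
  qed
  have last: "(\<Sum>i=1..k. h i) = (\<Sum>i=1..k - 1. h i) + h k" for h :: "nat \<Rightarrow> real"
    using k by (cases k) auto
  have "(\<Sum>i=1..k - 1. w i * (if i = k then -1 else 0)) = 0" "(\<Sum>i=1..k - 1. (if i = k then -1 else 0) * w i) = 0"
    for w :: "nat \<Rightarrow> real"
    using k by (auto intro!: sum.neutral)
  then show vk: "mean p k \<le> v k"
    using le[of "\<lambda>i. if i = k then -1 else 0"] unfolding last by simp
  show "v j = mean p j" if j: "j \<in> {1..k - 1}" for j
  proof (rule ccontr)
    assume ne: "v j \<noteq> mean p j"
    \<comment> \<open>moving along the \<open>j\<close>-th axis by \<open>s\<close> would exceed the bound \<open>v k - mean p k\<close> by \<open>1\<close>\<close>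
    define s where "s = (v k - mean p k + 1) / (v j - mean p j)"
    have jk: "j \<noteq> k" using j by auto
    let ?d = "\<lambda>i. if i = k then -1 else if i = j then s else 0"
    have sum: "(\<Sum>i=1..k - 1. w i * ?d i) = w j * s" for w :: "nat \<Rightarrow> real"
    proof -
      have "(\<Sum>i=1..k - 1. w i * ?d i) = (\<Sum>i=1..k - 1. if i = j then w j * s else 0)"
        by (intro sum.cong) auto
      then show ?thesis using j by simp
    qed
    have "v j * s - v k \<le> s * mean p j - mean p k"
      using le[of ?d] jk sum[of v] sum[of "mean p"] unfolding last by (simp add: mult.commute)
    then have "s * (v j - mean p j) \<le> v k - mean p k" by (simp add: algebra_simps)
    then show False using ne by (simp add: s_def)
  qed
qed

text \<open>
  A change of measure: tilting by \<open>q\<close> is tilting by \<open>p\<close> followed by tilting by \<open>q - p\<close>. It moves the study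
  of \<open>logmgf\<close> near \<open>p\<close> to exponential integrals against the probability measure \<open>nu k \<phi> (shift p)\<close>.
\<close>

lemma logmgf_shift:
  assumes p: "p k = 0" and P: "prob_space (nu k \<phi> (shift p))"
  shows "\<exists>h. logmgf k \<phi> p = ereal h \<and> (\<forall>q. logmgf k \<phi> q =
    ereal h + elog (\<integral>\<^sup>+x. ennreal (exp (dual (\<lambda>i. q i - p i) x)) \<partial>nu k \<phi> (shift p)))"
proof -
  interpret \<nu>: prob_space "nu k \<phi> (shift p)" by (rule P)
  have \<phi>1[measurable]: "(\<lambda>x. - \<phi> 1 x) \<in> borel_measurable pos_lborel"
    using \<phi>_meas[of 1] k by (intro borel_measurable_uminus) auto
  define Z0 where "Z0 = enn2real (partition_function (\<lambda>x. - \<phi> 1 x))"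
  define W where "W = enn2real (partition_function (energy (shift p)))"
  have Z0: "Z0 > 0" "partition_function (\<lambda>x. - \<phi> 1 x) = ennreal Z0"
    using partition_function_pos[OF \<phi>1] C2[of 1 1] k
    by (auto simp: Z0_def enn2real_positive_iff partition_function_def)
  have W: "W > 0" "partition_function (energy (shift p)) = ennreal W"
    unfolding W_def using norm_const[OF P] by auto
  have eq: "(\<integral>\<^sup>+x. ennreal (exp (dual q x)) \<partial>gibbs (\<lambda>x. - \<phi> 1 x))
    = ennreal (W / Z0) * (\<integral>\<^sup>+x. ennreal (exp (dual (\<lambda>i. q i - p i) x)) \<partial>nu k \<phi> (shift p))" for q
  proof -
    let ?I = "\<integral>\<^sup>+x. ennreal (exp (dual q x - \<phi> 1 x)) \<partial>pos_lborel"
    have 1: "(\<integral>\<^sup>+x. ennreal (exp (dual q x)) \<partial>gibbs (\<lambda>x. - \<phi> 1 x)) = ?I / ennreal Z0"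
      by (subst nn_integral_gibbs[OF \<phi>1]) (auto simp: Z0 ennreal_mult[symmetric] exp_diff exp_minus divide_inverse simp del: One_nat_def)
    have "exp (dual (\<lambda>i. q i - p i) x) * exp (energy (shift p) x) = exp (dual q x - \<phi> 1 x)" for x
      unfolding exp_add[symmetric] energy_shift[where p=p, OF p]
      by (simp add: left_diff_distrib sum_subtractf)
    then have 2: "(\<integral>\<^sup>+x. ennreal (exp (dual (\<lambda>i. q i - p i) x)) \<partial>nu k \<phi> (shift p)) = ?I / ennreal W"
      unfolding nu_def
      by (subst nn_integral_gibbs[OF energy_meas]) (auto simp: W ennreal_mult[symmetric] simp del: One_nat_def)
    show ?thesis unfolding 1 2 using Z0(1) W(1)
      by (cases ?I) (auto simp: divide_ennreal ennreal_mult[symmetric] ennreal_top_divide ennreal_mult_top)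
  qed
  have H: "logmgf k \<phi> q = ereal (ln (W / Z0))
      + elog (\<integral>\<^sup>+x. ennreal (exp (dual (\<lambda>i. q i - p i) x)) \<partial>nu k \<phi> (shift p))" for q
    unfolding logmgf_def eq using W(1) Z0(1) by (intro elog_cmult) simp
  have "logmgf k \<phi> p = ereal (ln (W / Z0))"
    unfolding H by (simp add: elog_def \<nu>.emeasure_space_1)
  then show ?thesis using H by blast
qed

lemma logmgf_finite_imp_prob:
  assumes p: "p k = 0" and H: "\<bar>logmgf k \<phi> p\<bar> \<noteq> \<infinity>"
  shows "prob_space (nu k \<phi> (shift p))"
proof (rule ccontr)
  assume "\<not> ?thesis"
  then have W: "partition_function (energy (shift p)) = \<infinity>"
    unfolding nu_def prob_space_gibbs_iff[OF energy_meas] by (simp only: not_less infinity_ennreal_def top_unique)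
  have \<phi>1[measurable]: "(\<lambda>x. - \<phi> 1 x) \<in> borel_measurable pos_lborel"
    using \<phi>_meas[of 1] k by (intro borel_measurable_uminus) auto
  have Z0: "partition_function (\<lambda>x. - \<phi> 1 x) < \<infinity>"
    using C2[of 1 1] k by (simp add: partition_function_def)
  have "(\<integral>\<^sup>+x. ennreal (exp (dual p x)) \<partial>gibbs (\<lambda>x. - \<phi> 1 x))
    = (\<integral>\<^sup>+x. ennreal (exp (dual p x - \<phi> 1 x)) \<partial>pos_lborel) / partition_function (\<lambda>x. - \<phi> 1 x)"
    by (subst nn_integral_gibbs[OF \<phi>1]) (auto simp: ennreal_mult[symmetric] exp_diff exp_minus divide_inverse)
  also have "\<dots> = \<infinity>"
    using W Z0 unfolding partition_function_def energy_shift[where p=p, OF p] by (simp add: ennreal_top_divide)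
  finally show False using H by (simp add: logmgf_def elog_def)
qed

lemma subdifferential_iff:
  assumes p: "p \<in> vecs k" "p k = 0" and P: "prob_space (nu k \<phi> (shift p))"
  shows "v \<in> subdifferential k (logmgf k \<phi>) p \<longleftrightarrow> v \<in> vecs k \<and>
    (\<forall>d\<in>vecs k. ennreal (exp (\<Sum>i=1..k. v i * d i)) \<le> (\<integral>\<^sup>+x. ennreal (exp (dual d x)) \<partial>nu k \<phi> (shift p)))"
proof -
  let ?E = "\<lambda>d. \<integral>\<^sup>+x. ennreal (exp (dual d x)) \<partial>nu k \<phi> (shift p)"
  obtain h where h: "logmgf k \<phi> p = ereal h"
    "\<And>q. logmgf k \<phi> q = ereal h + elog (?E (\<lambda>i. q i - p i))"
    using logmgf_shift[OF p(2) P] by blast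
  have cancel: "ereal h + ereal s \<le> ereal h + elog t \<longleftrightarrow> ennreal (exp s) \<le> t" for s t
    unfolding ereal_le_elog_iff[symmetric] by (cases "elog t") auto
  have "v \<in> subdifferential k (logmgf k \<phi>) p \<longleftrightarrow> v \<in> vecs k \<and>
    (\<forall>q\<in>vecs k. ennreal (exp (\<Sum>i=1..k. v i * (q i - p i))) \<le> ?E (\<lambda>i. q i - p i))"
    unfolding subdifferential_def h(2)[of q for q] mem_Collect_eq
    using h(1) by (simp add: h(2)[symmetric] del: plus_ereal.simps) (simp add: h cancel del: plus_ereal.simps)
  also have "\<dots> \<longleftrightarrow> v \<in> vecs k \<and> (\<forall>d\<in>vecs k. ennreal (exp (\<Sum>i=1..k. v i * d i)) \<le> ?E d)"
  proof (intro conj_cong refl iffI ballI)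
    fix d assume q: "\<forall>q\<in>vecs k. ennreal (exp (\<Sum>i=1..k. v i * (q i - p i))) \<le> ?E (\<lambda>i. q i - p i)"
      and d: "d \<in> vecs k"
    let ?q = "\<lambda>i\<in>{1..k}. p i + d i"
    have "(\<Sum>i=1..k. v i * (?q i - p i)) = (\<Sum>i=1..k. v i * d i)" by (intro sum.cong) auto
    moreover have "dual (\<lambda>i. ?q i - p i) x = dual d x" for x by (intro sum.cong) auto
    ultimately show "ennreal (exp (\<Sum>i=1..k. v i * d i)) \<le> ?E d"
      using q[rule_format, of ?q] by simp
  next
    fix q assume d: "\<forall>d\<in>vecs k. ennreal (exp (\<Sum>i=1..k. v i * d i)) \<le> ?E d" and q: "q \<in> vecs k"
    let ?d = "\<lambda>i\<in>{1..k}. q i - p i"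
    have "(\<Sum>i=1..k. v i * ?d i) = (\<Sum>i=1..k. v i * (q i - p i))" by (intro sum.cong) auto
    moreover have "dual ?d x = dual (\<lambda>i. q i - p i) x" for x by (intro sum.cong) auto
    ultimately show "ennreal (exp (\<Sum>i=1..k. v i * (q i - p i))) \<le> ?E (\<lambda>i. q i - p i)"
      using d[rule_format, of ?d] by simp
  qed
  finally show ?thesis .
qed

lemma mean_in_subdifferential:
  assumes p: "p \<in> vecs k" "p k = 0" and P: "prob_space (nu k \<phi> (shift p))"
  shows "restrict (mean (shift p)) {1..k} \<in> subdifferential k (logmgf k \<phi>) p"
proof -
  have "(\<Sum>i=1..k. restrict (mean (shift p)) {1..k} i * d i) = (\<Sum>i=1..k. d i * mean (shift p) i)" for d
    by (intro sum.cong) auto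
  then show ?thesis
    unfolding subdifferential_iff[OF p P] using jensen_exp[OF P] by auto
qed

lemma subdifferential_mean:
  assumes p: "p \<in> vecs k" "p k = 0" and v: "v \<in> subdifferential k (logmgf k \<phi>) p"
  shows "prob_space (nu k \<phi> (shift p))"
    and "\<And>i. i \<in> {1..k - 1} \<Longrightarrow> v i = mean (shift p) i" and "mean (shift p) k \<le> v k"
proof -
  show P: "prob_space (nu k \<phi> (shift p))"
    using v p by (intro logmgf_finite_imp_prob) (auto simp: subdifferential_def)
  have v': "\<And>d. d \<in> vecs k \<Longrightarrow>
      ennreal (exp (\<Sum>i=1..k. v i * d i)) \<le> (\<integral>\<^sup>+x. ennreal (exp (dual d x)) \<partial>nu k \<phi> (shift p))"
    using v unfolding subdifferential_iff[OF p P] by auto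
  show "\<And>i. i \<in> {1..k - 1} \<Longrightarrow> v i = mean (shift p) i" by (rule supporting_vector(1)[OF P v'])
  show "mean (shift p) k \<le> v k" by (rule supporting_vector(2)[OF P v'])
qed

end

section \<open>Moments determine the parameters\<close>

context potentials
begin

text \<open>
  Divided by its leading potential, which tends to infinity, the energy tends to a nonzero coefficient
  and a constant tends to \<open>0\<close>; hence they differ on a half-line.
\<close>

lemma energy_not_AE_const:
  assumes d: "i \<in> {1..k - 1}" "d i \<noteq> 0"
  shows "\<not> (AE x in pos_lborel. energy d x = F)"
proof
  assume ae: "AE x in pos_lborel. energy d x = F"
  define l where "l = Max {i \<in> {1..k - 1}. d i \<noteq> 0}"
  have "l \<in> {i \<in> {1..k - 1}. d i \<noteq> 0}" unfolding l_def using d by (intro Max_in) auto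
  then have l: "l \<in> {1..k - 1}" "d l \<noteq> 0" by auto
  have z: "d j = 0" if "j \<in> {1..k - 1}" "l < j" for j
  proof (rule ccontr)
    assume "d j \<noteq> 0"
    then have "j \<le> l" unfolding l_def using that(1) by (intro Max_ge) auto
    then show False using that(2) by simp
  qed
  have lim: "((\<lambda>x. energy d x / \<phi> l x) \<longlongrightarrow> d l) at_top"
    by (rule combination_ratio) (use l z in auto)
  have "filterlim (\<phi> l) at_top at_top" using l by (intro C1_lim) auto
  then have "((\<lambda>x. F / \<phi> l x) \<longlongrightarrow> 0) at_top"
    by (intro real_tendsto_divide_at_top[OF tendsto_const])
  from tendsto_diff[OF lim this] have "((\<lambda>x. energy d x / \<phi> l x - F / \<phi> l x) \<longlongrightarrow> d l) at_top" by simp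
  then have "\<forall>\<^sub>F x in at_top. energy d x / \<phi> l x - F / \<phi> l x \<noteq> 0"
    using l(2) by (rule tendsto_imp_eventually_ne)
  then have "\<forall>\<^sub>F x in at_top. energy d x \<noteq> F" by eventually_elim auto
  then obtain X0 where X0: "\<And>x. x \<ge> X0 \<Longrightarrow> energy d x \<noteq> F"
    unfolding eventually_at_top_linorder by blast
  define X where "X = max X0 1"
  have X: "X > 0" "\<And>x. x > X \<Longrightarrow> energy d x \<noteq> F"
    using X0 by (auto simp: X_def simp del: One_nat_def)
  let ?N = "{x \<in> space pos_lborel. \<not> energy d x = F}"
  have N: "?N \<in> sets pos_lborel" by measurable
  have "emeasure pos_lborel {X<..<X + 1} \<le> emeasure pos_lborel ?N"
  proof (rule emeasure_mono[OF _ N], rule subsetI)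
    fix x assume "x \<in> {X<..<X + 1}"
    then have x: "X < x" by simp
    then show "x \<in> ?N" using X(1) X(2)[OF x] by simp
  qed
  also have "\<dots> = 0" using ae by (subst (asm) AE_iff_measurable[OF N refl])
  finally have "emeasure pos_lborel {X<..<X + 1} = 0" by simp
  moreover have "emeasure pos_lborel {X<..<X + 1} = 1"
    using X by (subst emeasure_pos_lborel) auto
  ultimately show False by simp
qed

lemma nn_integral_exp_energy_diff:
  assumes P: "prob_space (nu k \<phi> p)" and Q: "prob_space (nu k \<phi> q)"
  shows "(\<integral>\<^sup>+x. ennreal (exp (energy q x - energy p x)) \<partial>nu k \<phi> p) = ennreal (norm_const q / norm_const p)"
proof -
  have "(\<integral>\<^sup>+x. ennreal (exp (energy q x - energy p x)) \<partial>nu k \<phi> p)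
    = (\<integral>\<^sup>+x. ennreal (exp (energy q x)) \<partial>pos_lborel) / partition_function (energy p)"
    unfolding nu_def
    by (subst nn_integral_gibbs[OF energy_meas])
      (auto simp: ennreal_mult[symmetric] exp_diff simp del: One_nat_def)
  also have "\<dots> = ennreal (norm_const q) / ennreal (norm_const p)"
    using norm_const(2)[OF P] norm_const(2)[OF Q] by (simp add: partition_function_def del: One_nat_def)
  also have "\<dots> = ennreal (norm_const q / norm_const p)"
    using norm_const(1)[OF P] norm_const(1)[OF Q] by (intro divide_ennreal) auto
  finally show ?thesis .
qed

lemma energy_diff: "energy (\<lambda>i. q i - p i) x = energy q x - energy p x"
  by (simp add: left_diff_distrib sum_subtractf)

lemma jensen_energy:
  assumes P: "prob_space (nu k \<phi> p)" and Q: "prob_space (nu k \<phi> q)"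
  shows "exp (\<Sum>i=1..k - 1. (q i - p i) * mean p i) \<le> norm_const q / norm_const p"
proof -
  let ?d = "\<lambda>i. if i = k then 0 else q i - p i"
  have e: "(\<Sum>i=1..k. ?d i * w i) = (\<Sum>i=1..k - 1. (q i - p i) * w i)" for w :: "nat \<Rightarrow> real"
    by (rule sum.mono_neutral_cong_right) auto
  have "ennreal (exp (\<Sum>i=1..k - 1. (q i - p i) * mean p i)) \<le> ennreal (norm_const q / norm_const p)"
    using jensen_exp[where p=p and d="?d", OF P]
    unfolding e energy_diff nn_integral_exp_energy_diff[OF P Q] .
  then show ?thesis
    using norm_const(1)[OF P] norm_const(1)[OF Q] by (subst (asm) ennreal_le_iff) auto
qed

text \<open>
  Let \<open>F\<close> be the common mean of \<open>energy q - energy p\<close> under both measures. Jensen's inequality under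
  \<open>nu k \<phi> p\<close> gives \<open>exp F \<le> norm_const q / norm_const p\<close>, and under \<open>nu k \<phi> q\<close> the reverse
  inequality. In the case of equality the two energies differ by the constant \<open>F\<close> almost everywhere.
\<close>

lemma mean_determines_parameter:
  assumes P: "prob_space (nu k \<phi> p)" and Q: "prob_space (nu k \<phi> q)"
    and eq: "\<And>i. i \<in> {1..k - 1} \<Longrightarrow> mean p i = mean q i"
    and i: "i \<in> {1..k - 1}"
  shows "p i = q i"
proof (rule ccontr)
  assume ne: "p i \<noteq> q i"
  interpret \<nu>: prob_space "nu k \<phi> p" by (rule P)
  define F where "F = (\<Sum>i=1..k - 1. (q i - p i) * mean p i)"
  have F': "(\<Sum>i=1..k - 1. (p i - q i) * mean q i) = - F"
    unfolding F_def sum_negf[symmetric] by (intro sum.cong) (auto simp: eq algebra_simps)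
  have pq: "norm_const p > 0" "norm_const q > 0" using norm_const(1)[OF P] norm_const(1)[OF Q] by auto
  have "exp F \<le> norm_const q / norm_const p" unfolding F_def by (rule jensen_energy[OF P Q])
  moreover have "exp (- F) \<le> norm_const p / norm_const q" using jensen_energy[OF Q P] unfolding F' .
  then have "norm_const q / norm_const p \<le> exp F" using pq by (simp add: exp_minus field_simps)
  ultimately have F: "norm_const q / norm_const p = exp F" by simp
  define g where "g x = energy q x - energy p x - F" for x
  have gm[measurable]: "g \<in> borel_measurable pos_lborel" unfolding g_def by measurable
  have \<phi>_int: "integrable (nu k \<phi> p) (\<phi> j)" if "j \<in> {1..k - 1}" for j
    using that by (intro \<phi>_integrable[OF P]) auto
  have diff_int: "integrable (nu k \<phi> p) (\<lambda>x. energy r x)" for r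
    using \<phi>_int by auto
  have gint: "integrable (nu k \<phi> p) g"
    unfolding g_def by (intro Bochner_Integration.integrable_diff diff_int) simp
  have g0: "(LINT x|nu k \<phi> p. g x) = 0"
  proof -
    have "(LINT x|nu k \<phi> p. energy (\<lambda>i. q i - p i) x) = F"
      unfolding F_def using \<phi>_int
      by (subst Bochner_Integration.integral_sum) (auto simp: mean_def)
    then show ?thesis
      using diff_int unfolding g_def energy_diff
      by (subst Bochner_Integration.integral_diff) (auto simp: \<nu>.prob_space)
  qed
  have "(\<integral>\<^sup>+x. ennreal (exp (g x)) \<partial>nu k \<phi> p) = ennreal (exp (- F)) * ennreal (norm_const q / norm_const p)"
    unfolding nn_integral_exp_energy_diff[OF P Q, symmetric]
    by (subst nn_integral_cmult[symmetric])
      (auto simp: g_def ennreal_mult[symmetric] exp_diff exp_minus divide_inverse mult.commute meas_\<nu>[OF P] simp del: One_nat_def)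
  also have "\<dots> = 1" unfolding F by (simp add: ennreal_mult[symmetric] flip: exp_add)
  finally have eg: "(\<integral>\<^sup>+x. ennreal (exp (g x)) \<partial>nu k \<phi> p) = ennreal 1" by simp
  have egint: "integrable (nu k \<phi> p) (\<lambda>x. exp (g x))"
    by (rule integrableI_nn_integral_finite[OF _ _ eg]) (auto simp: meas_\<nu>[OF P])
  have eg1: "(LINT x|nu k \<phi> p. exp (g x)) = 1"
    by (rule integral_eq_nn_integral[THEN trans]) (use eg in \<open>auto simp: meas_\<nu>[OF P]\<close>)
  have "AE x in nu k \<phi> p. exp (g x) - (1 + g x) = 0"
  proof (subst integral_nonneg_eq_0_iff_AE[symmetric])
    show "integrable (nu k \<phi> p) (\<lambda>x. exp (g x) - (1 + g x))" using egint gint by auto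
    show "AE x in nu k \<phi> p. 0 \<le> exp (g x) - (1 + g x)" by (simp add: exp_ge_add_one_self)
    show "(LINT x|nu k \<phi> p. exp (g x) - (1 + g x)) = 0"
      using egint gint eg1 g0 by (simp add: \<nu>.prob_space)
  qed
  then have "AE x in nu k \<phi> p. energy (\<lambda>i. q i - p i) x = F"
  proof eventually_elim
    case (elim x)
    then have "g x = 0" using exp_eq_one_plus_iff[of "g x"] by simp
    then show ?case unfolding energy_diff by (simp add: g_def)
  qed
  then have "AE x in density pos_lborel (\<lambda>x. ennreal (exp (energy p x) / norm_const p)). energy (\<lambda>i. q i - p i) x = F"
    unfolding nu_def gibbs_eq_density[OF energy_meas Z_fin[OF P]] .
  then have "AE x in pos_lborel. 0 < ennreal (exp (energy p x) / norm_const p) \<longrightarrow> energy (\<lambda>i. q i - p i) x = F"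
    by (subst (asm) AE_density) measurable
  then have "AE x in pos_lborel. energy (\<lambda>i. q i - p i) x = F"
    using pq by (auto elim!: eventually_mono simp del: One_nat_def)
  then show False using energy_not_AE_const[of i "\<lambda>i. q i - p i" F] i ne by auto
qed

lemma fits_mean:
  assumes "fits k \<phi> a p"
  shows "prob_space (nu k \<phi> p)" "\<And>i. i \<in> {1..k - 1} \<Longrightarrow> ennreal (mean p i) = ennreal (a i)"
proof -
  show P: "prob_space (nu k \<phi> p)" using assms by (simp add: fits_def)
  show "ennreal (mean p i) = ennreal (a i)" if i: "i \<in> {1..k - 1}" for i
  proof -
    have "(\<integral>\<^sup>+x. ennreal (\<phi> i x) \<partial>nu k \<phi> p) = ennreal (a i)" using assms i by (auto simp: fits_def)
    moreover have "i \<in> {1..k}" using i by auto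
    ultimately show ?thesis using nn_integral_\<phi>(1)[OF P] by simp
  qed
qed

lemma fits_unique:
  assumes "fits k \<phi> a p" "fits k \<phi> a q"
  shows "p = q"
proof (rule PiE_ext)
  show "p \<in> vecs (k - 1)" "q \<in> vecs (k - 1)" using assms by (auto simp: fits_def)
  have eq: "mean p i = mean q i" if "i \<in> {1..k - 1}" for i
  proof -
    have "ennreal (mean p i) = ennreal (mean q i)"
      using fits_mean(2)[OF assms(1) that] fits_mean(2)[OF assms(2) that] by simp
    moreover have "i \<in> {1..k}" using that by auto
    ultimately show ?thesis
      using nn_integral_\<phi>(2)[OF fits_mean(1)[OF assms(1)], of i] nn_integral_\<phi>(2)[OF fits_mean(1)[OF assms(2)], of i]
      by (subst (asm) ennreal_inj) auto
  qed
  show "p i = q i" if "i \<in> {1..k - 1}" for i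
    by (rule mean_determines_parameter[OF fits_mean(1)[OF assms(1)] fits_mean(1)[OF assms(2)] eq that])
qed

lemma tilt_fits:
  assumes t: "t \<in> tilts k \<phi> (proj1 k a)"
  shows "fits k \<phi> a (shift t)" "\<And>i. i \<in> {1..k - 1} \<Longrightarrow> a i = mean (shift t) i"
proof -
  from t obtain w where tk: "t \<in> vecs k" "t k = 0" and w: "w \<in> subdifferential k (logmgf k \<phi>) t"
    and aw: "proj1 k a = proj1 k w"
    by (auto simp: tilts_def)
  have P: "prob_space (nu k \<phi> (shift t))" by (rule subdifferential_mean(1)[OF tk w])
  show mean: "a i = mean (shift t) i" if i: "i \<in> {1..k - 1}" for i
  proof -
    have "a i = w i" using fun_cong[OF aw, of i] i by (simp add: proj1_def)
    then show ?thesis using subdifferential_mean(2)[OF tk w i] by simp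
  qed
  have "(\<integral>\<^sup>+x. ennreal (\<phi> i x) \<partial>nu k \<phi> (shift t)) = ennreal (a i)" if i: "i \<in> {1..k - 1}" for i
  proof -
    have "i \<in> {1..k}" using i by auto
    then show ?thesis using nn_integral_\<phi>(1)[OF P] mean[OF i] by simp
  qed
  then show "fits k \<phi> a (shift t)" using P by (auto simp: fits_def shift_def)
qed

text \<open>
  The infimum is a minimum, attained at the moment vector of the measure; the definite description in
  \<open>g2\<close> denotes \<open>t\<close> because tilts with the same moments coincide.
\<close>

lemma g2_eq_mean:
  assumes t: "t \<in> tilts k \<phi> (proj1 k a)"
  shows "g2 k \<phi> (proj1 k a) = mean (shift t) k"
proof -
  have tk: "t \<in> vecs k" "t k = 0" using t by (auto simp: tilts_def)
  have uniq: "t' = t" if t': "t' \<in> tilts k \<phi> (proj1 k a)" for t'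
  proof (rule PiE_ext)
    show "t' \<in> vecs k" "t \<in> vecs k" using t t' by (auto simp: tilts_def)
    have "shift t' = shift t" using fits_unique[OF tilt_fits(1)[OF t'] tilt_fits(1)[OF t]] .
    then have e: "t' i = t i" if "i \<in> {1..k - 1}" for i
    proof -
      have "shift t' i = shift t i" using \<open>shift t' = shift t\<close> by (simp only:)
      then show ?thesis using that by (simp add: shift_def)
    qed
    have "t' k = t k" using t t' by (auto simp: tilts_def)
    then show "t' i = t i" if "i \<in> {1..k}" for i using e[of i] that by (cases "i = k") auto
  qed
  have "(THE p. p \<in> tilts k \<phi> (proj1 k a)) = t" using t uniq by (rule the_equality)
  then have "g2 k \<phi> (proj1 k a) = Inf ((\<lambda>w. w k) ` subdifferential k (logmgf k \<phi>) t)"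
    by (simp add: g2_def)
  also have "\<dots> = mean (shift t) k"
  proof (rule cInf_eq_minimum)
    from t obtain w where w: "w \<in> subdifferential k (logmgf k \<phi>) t" by (auto simp: tilts_def)
    have "restrict (mean (shift t)) {1..k} \<in> subdifferential k (logmgf k \<phi>) t"
      by (rule mean_in_subdifferential[OF tk subdifferential_mean(1)[OF tk w]])
    then show "mean (shift t) k \<in> (\<lambda>w. w k) ` subdifferential k (logmgf k \<phi>) t"
      using k by (intro image_eqI) auto
  qed (use subdifferential_mean(3)[OF tk] in auto)
  finally show ?thesis .
qed

end

section \<open>Localization\<close>

theorem theorem2p7:
  fixes k :: nat and \<phi> :: "nat \<Rightarrow> real \<Rightarrow> real" and a \<gamma> :: "nat \<Rightarrow> real"
  assumes k: "k \<ge> 2"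
    and pos: "\<And>i x. i \<in> {1..k} \<Longrightarrow> x > 0 \<Longrightarrow> \<phi> i x > 0"
    and C1_smooth: "\<And>i. i \<in> {1..k} \<Longrightarrow> \<phi> i C1_differentiable_on {0<..}"
    and C1_mono: "\<And>i. i \<in> {1..k} \<Longrightarrow> mono_on {0<..} (\<phi> i)"
    and C1_lim: "\<And>i. i \<in> {1..k} \<Longrightarrow> filterlim (\<phi> i) at_top at_top"
    and C2: "\<And>i c. i \<in> {1..k} \<Longrightarrow> c > 0 \<Longrightarrow>
      (\<integral>\<^sup>+x. ennreal (exp (- c * \<phi> i x)) \<partial>pos_lborel) < \<infinity>"
    and C3: "\<exists>\<kappa>>1. \<forall>i\<in>{1..k - 1}. \<forall>\<^sub>F x in at_top. \<phi> i x powr \<kappa> < \<phi> (i + 1) x"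
    and C4: "\<exists>C>0. \<exists>M>0. \<forall>i\<in>{1..k}. \<forall>x>C.
      1 / C * \<phi> i x powr (- M) < deriv (\<phi> i) x \<and> deriv (\<phi> i) x < C * \<phi> i x powr M"
    and g1_cont: "continuous_map (subtopology (vecs_top (k - 1)) (A1 k \<phi>)) euclideanreal (g1 k \<phi>)"
    and a_adm: "a \<in> admissible k \<phi>"
    and a_S1: "proj1 k a \<in> S1 k \<phi>"
    and a_g2: "a k > g2 k \<phi> (proj1 k a)"
    and \<gamma>_range: "\<And>i. i \<in> {1..k - 1} \<Longrightarrow> 0 < \<gamma> i \<and> \<gamma> i < 1"
    and \<gamma>_lim: "\<And>i. i \<in> {1..k - 1} \<Longrightarrow>
      ((\<lambda>x. \<phi> i (inv_into {0<..} (\<phi> k) x) / x powr \<gamma> i) \<longlongrightarrow> 1) at_top"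
  shows "(\<exists>!p. fits k \<phi> a p) \<and>
    (\<forall>p. fits k \<phi> a p \<longrightarrow>
      (let Q = iid (nu k \<phi> p);
           m = Max {i \<in> {1..k - 1}. p i \<noteq> 0};
           b = a k - g2 k \<phi> (proj1 k a)
       in (\<forall>\<epsilon>>0.
             Limsup (at_right 0) (\<lambda>\<delta>. limsup (\<lambda>n.
               ereal (1 / real n powr \<gamma> m) *
               elog (ennreal (\<P>(\<omega> in Q. max_share (\<phi> k) n \<omega> < b - \<epsilon> \<bar> near k \<phi> a \<delta> n \<omega>))))) < 0) \<and>
          (\<forall>\<epsilon>>0. \<exists>L.
             (\<forall>\<^sub>F \<delta> in at_right 0.
               (\<lambda>n. \<P>(\<omega> in Q. \<bar>max_share (\<phi> k) n \<omega> - b\<bar> < \<epsilon> \<bar> near k \<phi> a \<delta> n \<omega>))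
                 \<longlonglongrightarrow> L \<delta>) \<and>
             (L \<longlongrightarrow> 1) (at_right 0))))"
proof -
  interpret potentials k \<phi> \<gamma>
    by unfold_locales (fact k pos C1_smooth C1_mono C1_lim C2 C3 C4 \<gamma>_range \<gamma>_lim)+
  obtain t where t: "t \<in> tilts k \<phi> (proj1 k a)" using a_S1 by (auto simp: S1_def)
  define p where "p = shift t"
  have fit: "fits k \<phi> a p" unfolding p_def by (rule tilt_fits(1)[OF t])
  have P: "prob_space (nu k \<phi> p)" using fit by (simp add: fits_def)
  interpret big_jump "nu k \<phi> p" k \<phi> "\<gamma> (leading p)" "- p (leading p)" by (rule big_jump_nu[OF P])
  define b where "b = a k - g2 k \<phi> (proj1 k a)"
  have a_mean: "a i = (LINT x|nu k \<phi> p. \<phi> i x)" if "i \<in> {1..k - 1}" for i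
    using tilt_fits(2)[OF t that] by (simp add: p_def mean_def)
  have a_excess: "a k = (LINT x|nu k \<phi> p. \<phi> k x) + b"
    using g2_eq_mean[OF t] by (simp add: b_def p_def mean_def)
  have b: "b > 0" using a_g2 by (simp add: b_def)
  have lim: "\<exists>L. (\<forall>\<^sub>F \<delta> in at_right 0.
      (\<lambda>n. \<P>(\<omega> in iid (nu k \<phi> p). \<bar>max_share (\<phi> k) n \<omega> - b\<bar> < \<epsilon> \<bar> near k \<phi> a \<delta> n \<omega>)) \<longlonglongrightarrow> L \<delta>) \<and>
      (L \<longlongrightarrow> 1) (at_right (0::real))" if "\<epsilon> > 0" for \<epsilon>
    using localization[OF a_mean a_excess b that] by (intro exI[of _ "\<lambda>_. 1"] conjI tendsto_const)
  show ?thesis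
  proof (intro conjI ex1I[of _ p] fit allI impI)
    show same: "q = p" if "fits k \<phi> a q" for q using fits_unique[OF that fit] .
    fix q assume "fits k \<phi> a q"
    then have q: "q = p" by (rule same)
    show "let Q = iid (nu k \<phi> q); m = Max {i \<in> {1..k - 1}. q i \<noteq> 0}; b = a k - g2 k \<phi> (proj1 k a)
       in (\<forall>\<epsilon>>0.
             Limsup (at_right 0) (\<lambda>\<delta>. limsup (\<lambda>n.
               ereal (1 / real n powr \<gamma> m) *
               elog (ennreal (\<P>(\<omega> in Q. max_share (\<phi> k) n \<omega> < b - \<epsilon> \<bar> near k \<phi> a \<delta> n \<omega>))))) < 0) \<and>
          (\<forall>\<epsilon>>0. \<exists>L.
             (\<forall>\<^sub>F \<delta> in at_right 0.
               (\<lambda>n. \<P>(\<omega> in Q. \<bar>max_share (\<phi> k) n \<omega> - b\<bar> < \<epsilon> \<bar> near k \<phi> a \<delta> n \<omega>))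
                 \<longlonglongrightarrow> L \<delta>) \<and>
             (L \<longlongrightarrow> 1) (at_right 0))"
      unfolding q Let_def b_def[symmetric] leading_def[symmetric]
      using undershoot_rate[OF a_mean a_excess b] lim by blast
  qed
qed

end
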